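(* Let $x^0\in H$. Let $X^\pm$ be the solutions of $$X^\pm(t)=x^0+\int_0^t b^\pm(s,X^\pm(s))\,ds,\quad t\in[0,\tau_H^\pm],\qquad \tau_H^\pm=\inf\{t>0:\ X^\pm(t)\in H\}.$$ (+) Suppose there exist $T>0$, $\delta>0$, $c>0$ such that for all $t\in[0,T]$: $b_d^+(t,x)\ge c$ for all $x$ with $x_d>0$, $|x-x^0|\le\delta$, and $b_d^-(t,x)\ge0$ for all $x\in H$ with $|x-x^0|\le\delta$. Then $$X^\varepsilon(\cdot\wedge\tau_H^+)\to X^+(\cdot\wedge\tau_H^+),\quad \varepsilon\to0,\ \text{ almost surely.}$$ (−) Suppose there exist $T>0$, $\delta>0$, $c>0$ such that for all $t\in[0,T]$: $b_d^-(t,x)\le -c$ for all $x$ with $x_d<0$, $|x-x^0|\le\delta$, and $b_d^+(t,x)\le0$ for all $x\in H$ with $|x-x^0|\le\delta$. Then $$X^\varepsilon(\cdot\wedge\tau_H^-)\to X^-(\cdot\wedge\tau_H^-),\quad \varepsilon\to0,\ \text{ almost surely.}$$ Convergence is in $C([0,\infty),\mathbb{R}^d)$.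
   Context: Write $x=(x_1,\dots,x_d)=(\bar x,x_d)\in\mathbb{R}^d$ and $H=\{x\in\mathbb{R}^d: x_d=0\}$. The functions $b^\pm:[0,\infty)\times\mathbb{R}^d\to\mathbb{R}^d$ are measurable, locally bounded, and satisfy a Lipschitz condition in $x$ on $\mathbb{R}^d$ (with constant independent of $t$). Set $b(t,x)=b^+(t,x)\mathbf 1_{x_d\ge0}+b^-(t,x)\mathbf 1_{x_d<0}$; $b_d^\pm$ denote the $d$-th coordinates. For $\varepsilon>0$, $X^\varepsilon$ is the unique strong solution of $$X^\varepsilon(t)=x^0+\int_0^t b(s,X^\varepsilon(s))\,ds+\varepsilon w(t),\quad t\ge0,$$ where $w$ is a $d$-dimensional Wiener process (the same for all $\varepsilon$). The space $C([0,\infty),\mathbb{R}^d)$ carries the topology of uniform convergence on compact sets; $a\wedge b=\min(a,b)$.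
   Formalization: As each X^ε is determined only up to an ε-dependent null set, a.s. convergence over all real ε→0 is ill-defined; it is proved along any set of ε>0 for which the equations hold off one common null set (automatic for every sequence ε_n→0; all ε>0 for jointly chosen versions). *)

theory Defs
  imports "HOL-Probability.Probability"
begin

definition admissible_drift :: "(real \<Rightarrow> real ^ 'n \<Rightarrow> real ^ 'n) \<Rightarrow> bool" where
  "admissible_drift f \<longleftrightarrow>
     (\<lambda>(t, x). f t x) \<in> borel_measurable (restrict_space borel ({0..} \<times> UNIV)) \<and>
     (\<forall>t\<ge>0. \<forall>x. \<exists>r>0. bounded ((\<lambda>(s, y). f s y) ` (ball (t, x) r \<inter> {0..} \<times> UNIV))) \<and>
     (\<exists>L. \<forall>t\<ge>0. L-lipschitz_on UNIV (f t))"

(* The index d is the distinguished coordinate whose vanishing defines the hyperplane H. *)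

definition hyperplane :: "'n \<Rightarrow> (real ^ 'n) set" where
  "hyperplane d = {x. x $ d = 0}"

definition glued_drift ::
  "'n \<Rightarrow> (real \<Rightarrow> real ^ 'n \<Rightarrow> real ^ 'n) \<Rightarrow> (real \<Rightarrow> real ^ 'n \<Rightarrow> real ^ 'n) \<Rightarrow> real \<Rightarrow> real ^ 'n \<Rightarrow> real ^ 'n"
  where
  "glued_drift d bp bm t x = (if x $ d \<ge> 0 then bp t x else bm t x)"

(* X is continuous on I and X(t) = x0 + int_0^t f(s, X(s)) ds + g(t) for t in I; integrability is
   demanded because the Lebesgue integral of a non-integrable function is 0 by convention. *)
definition solves_integral_eq ::
  "(real \<Rightarrow> real ^ 'n \<Rightarrow> real ^ 'n) \<Rightarrow> real ^ 'n \<Rightarrow> (real \<Rightarrow> real ^ 'n) \<Rightarrow> real set \<Rightarrow> (real \<Rightarrow> real ^ 'n) \<Rightarrow> bool"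
  where
  "solves_integral_eq f x0 g I X \<longleftrightarrow>
     continuous_on I X \<and>
     (\<forall>t\<in>I. set_integrable lborel {0..t} (\<lambda>s. f s (X s)) \<and>
            X t = x0 + (LBINT s:{0..t}. f s (X s)) + g t)"

(* Standard Wiener process: starts at 0, independent increments, increments over [s,t]
   distributed as N(0, (t-s) Id), continuous paths. *)
definition wiener_process :: "'a measure \<Rightarrow> (real \<Rightarrow> 'a \<Rightarrow> real ^ 'n) \<Rightarrow> bool" where
  "wiener_process M w \<longleftrightarrow>
     prob_space M \<and>
     (\<forall>t\<ge>0. w t \<in> borel_measurable M) \<and>
     (AE \<omega> in M. w 0 \<omega> = 0) \<and>
     (\<forall>(t :: nat \<Rightarrow> real) n. 0 \<le> t 0 \<longrightarrow> (\<forall>i<n. t i \<le> t (Suc i)) \<longrightarrow>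
        prob_space.indep_vars M (\<lambda>_. borel) (\<lambda>i \<omega>. w (t (Suc i)) \<omega> - w (t i) \<omega>) {..<n}) \<and>
     (\<forall>s t. 0 \<le> s \<longrightarrow> s < t \<longrightarrow>
        prob_space.indep_vars M (\<lambda>_. borel) (\<lambda>i \<omega>. (w t \<omega> - w s \<omega>) $ i) UNIV \<and>
        (\<forall>i. distributed M lborel (\<lambda>\<omega>. (w t \<omega> - w s \<omega>) $ i)
               (\<lambda>y. ennreal (normal_density 0 (sqrt (t - s)) y)))) \<and>
     (AE \<omega> in M. continuous_on {0..} (\<lambda>t. w t \<omega>))"

(* Natural filtration of w, augmented by all subsets of null sets. *)
definition augmented_filtration ::
  "'a measure \<Rightarrow> (real \<Rightarrow> 'a \<Rightarrow> real ^ 'n) \<Rightarrow> real \<Rightarrow> 'a measure" where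
  "augmented_filtration M w t =
     sigma (space M)
       ({w s -` A \<inter> space M | s A. 0 \<le> s \<and> s \<le> t \<and> A \<in> sets borel} \<union> null_sets (completion M))"

definition strong_solution ::
  "'a measure \<Rightarrow> (real \<Rightarrow> 'a \<Rightarrow> real ^ 'n) \<Rightarrow> (real \<Rightarrow> real ^ 'n \<Rightarrow> real ^ 'n) \<Rightarrow> real ^ 'n \<Rightarrow> real \<Rightarrow>
   (real \<Rightarrow> 'a \<Rightarrow> real ^ 'n) \<Rightarrow> bool" where
  "strong_solution M w f x0 \<epsilon> Y \<longleftrightarrow>
     (\<forall>t\<ge>0. Y t \<in> borel_measurable (augmented_filtration M w t)) \<and>
     (AE \<omega> in M. solves_integral_eq f x0 (\<lambda>t. \<epsilon> *\<^sub>R w t \<omega>) {0..} (\<lambda>t. Y t \<omega>))"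

(* Infinite if the path never visits H at a positive time. *)
definition hitting_time :: "'n \<Rightarrow> (real \<Rightarrow> real ^ 'n) \<Rightarrow> ereal" where
  "hitting_time d Y = Inf {ereal t | t. t > 0 \<and> Y t \<in> hyperplane d}"

(* The path Y(min t tau); only used for t >= 0 and tau >= 0, where min t tau is finite. *)
definition stopped :: "ereal \<Rightarrow> (real \<Rightarrow> real ^ 'n) \<Rightarrow> real \<Rightarrow> real ^ 'n" where
  "stopped \<tau> Y t = Y (real_of_ereal (min (ereal t) \<tau>))"

(* Solution of the noiseless equation up to, and including, its own hitting time of H. *)
definition solves_until_hitting ::
  "'n \<Rightarrow> (real \<Rightarrow> real ^ 'n \<Rightarrow> real ^ 'n) \<Rightarrow> real ^ 'n \<Rightarrow> (real \<Rightarrow> real ^ 'n) \<Rightarrow> bool" where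
  "solves_until_hitting d f x0 Y \<longleftrightarrow>
     solves_integral_eq f x0 (\<lambda>_. 0) {t. 0 \<le> t \<and> ereal t \<le> hitting_time d Y} Y"

(* Convergence in C([0,\<infinity>), R^d): uniform on compact subsets of [0,\<infinity>). *)
definition locally_uniform_limit ::
  "('e \<Rightarrow> real \<Rightarrow> real ^ 'n) \<Rightarrow> (real \<Rightarrow> real ^ 'n) \<Rightarrow> 'e filter \<Rightarrow> bool" where
  "locally_uniform_limit Y Z F \<longleftrightarrow>
     (\<forall>K. compact K \<longrightarrow> K \<subseteq> {0..} \<longrightarrow> uniform_limit K Y Z F)"

(* A strong solution is determined only up to a null set that may depend on epsilon, so almost
   sure convergence along an uncountable set of epsilons refers to versions with a common
   exceptional null set. For countable E (e.g. the range of a sequence) this holds for all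
   versions; E = {0<..} gives convergence as epsilon runs through all positive numbers. *)
definition common_null_set ::
  "'a measure \<Rightarrow> (real \<Rightarrow> 'a \<Rightarrow> real ^ 'n) \<Rightarrow> (real \<Rightarrow> real ^ 'n \<Rightarrow> real ^ 'n) \<Rightarrow> real ^ 'n \<Rightarrow> real set \<Rightarrow>
   (real \<Rightarrow> real \<Rightarrow> 'a \<Rightarrow> real ^ 'n) \<Rightarrow> bool" where
  "common_null_set M w f x0 E X \<longleftrightarrow>
     (AE \<omega> in M. \<forall>\<epsilon>\<in>E. solves_integral_eq f x0 (\<lambda>t. \<epsilon> *\<^sub>R w t \<omega>) {0..} (\<lambda>t. X \<epsilon> t \<omega>))"

lemma common_null_set_countable:
  assumes "countable E" "E \<subseteq> {0<..}" "\<And>\<epsilon>. \<epsilon> > 0 \<Longrightarrow> strong_solution M w f x0 \<epsilon> (X \<epsilon>)"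
  shows "common_null_set M w f x0 E X"
  using assms unfolding common_null_set_def strong_solution_def
  by (subst AE_ball_countable) auto

end

theory Submission
  imports Defs
begin

text \<open>The argument is pathwise. Let \<open>e\<close> be the unit normal of \<open>H\<close> pointing into the half-space
  that the path should enter, and let \<open>y = X\<^sup>\<epsilon> \<bullet> e\<close> be the height of the perturbed path. Below
  \<open>H\<close> the Lipschitz condition bounds the downward drift by \<open>L * \<bar>y\<bar>\<close>, so Gronwall gives
  \<open>y \<ge> - K * \<epsilon>\<close> up to a fixed time, and hence \<open>y t - y s \<ge> \<epsilon> * (w t - w s) \<bullet> e - C * \<epsilon> * (t - s)\<close>.
  Almost surely \<open>w t \<bullet> e > C * t\<close> at arbitrarily small times \<open>t\<close>; by continuity \<open>y\<close> is then
  positive on a short time interval which does not depend on \<open>\<epsilon>\<close>, on which the transversal drift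
  lifts it to a height independent of \<open>\<epsilon>\<close>. For small \<open>\<epsilon>\<close> the path therefore stays above \<open>H\<close>
  after an arbitrarily short initial phase, where it solves the equation with a single Lipschitz drift
  and Gronwall compares it with the noiseless solution.\<close>

section \<open>Integral equations with additive noise\<close>

text \<open>The majorant \<open>A + L * v\<close>, damped by \<open>exp (- L * (t - a))\<close>, is
  the function \<open>g\<close>, whose derivative is nonpositive by \<open>bound\<close>; comparing
  \<open>g t\<close> with \<open>g a\<close> gives the estimate.\<close>

lemma gronwall:
  fixes u :: "real \<Rightarrow> real"
  assumes cont: "continuous_on {a..b} u" and L: "0 \<le> L"
    and bound: "\<And>t. t \<in> {a..b} \<Longrightarrow> u t \<le> A + L * integral {a..t} u"
    and t: "t \<in> {a..b}"
  shows "u t \<le> A * exp (L * (t - a))"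
proof -
  define v where "v = (\<lambda>t. integral {a..t} u)"
  define g where "g = (\<lambda>t. exp (- L * (t - a)) * (A + L * v t))"
  have v_deriv: "(v has_real_derivative u s) (at s)" if "a < s" "s < b" for s
  proof -
    have "(v has_real_derivative u s) (at s within {a..b})"
      unfolding v_def by (rule integral_has_real_derivative[OF cont]) (use that in auto)
    moreover have "at s within {a..b} = at s"
      using that by (intro at_within_interior) auto
    ultimately show ?thesis by simp
  qed
  have "continuous_on {a..b} v"
    unfolding v_def by (intro indefinite_integral_continuous_1 integrable_continuous_real cont)
  then have g_cont: "continuous_on {a..t} g"
    unfolding g_def using t by (intro continuous_intros) (auto elim: continuous_on_subset)
  have g_deriv: "\<exists>y. (g has_real_derivative y) (at s) \<and> y \<le> 0" if "a < s" "s < t" for s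
  proof (intro exI conjI)
    show "(g has_real_derivative (exp (- L * (s - a)) * (L * (u s - (A + L * v s))))) (at s)"
      unfolding g_def using that t
      by (auto intro!: derivative_eq_intros v_deriv simp: algebra_simps)
    have "u s \<le> A + L * v s" using bound[of s] that t by (simp add: v_def)
    then show "exp (- L * (s - a)) * (L * (u s - (A + L * v s))) \<le> 0"
      using L by (intro mult_nonneg_nonpos) auto
  qed
  have "g t \<le> g a"
    using t by (intro DERIV_nonpos_imp_decreasing_open[OF _ _ g_cont] g_deriv) auto
  have "u t \<le> A + L * v t" using bound[OF t] by (simp add: v_def)
  also have "\<dots> = exp (L * (t - a)) * g t"
    by (simp add: g_def flip: mult.assoc exp_add)
  also have "\<dots> \<le> exp (L * (t - a)) * A"
    using \<open>g t \<le> g a\<close> by (simp add: g_def v_def)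
  finally show ?thesis by (simp add: mult.commute)
qed

text \<open>The equation is imposed on increments over all subintervals, so that estimates can start
  at any time; \<open>has_integral\<close> records integrability together with the value. Noisy and
  noiseless paths differ only in the deterministic function \<open>g\<close>.\<close>

definition driven_path ::
  "(real \<Rightarrow> 'v \<Rightarrow> 'v) \<Rightarrow> 'v \<Rightarrow> (real \<Rightarrow> 'v) \<Rightarrow> real \<Rightarrow> (real \<Rightarrow> 'v::euclidean_space) \<Rightarrow> bool" where
  "driven_path f x0 g S X \<longleftrightarrow>
     continuous_on {0..S} X \<and> X 0 = x0 + g 0 \<and>
     (\<forall>s t. 0 \<le> s \<longrightarrow> s \<le> t \<longrightarrow> t \<le> S \<longrightarrow>
        ((\<lambda>r. f r (X r)) has_integral (X t - X s - (g t - g s))) {s..t})"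

lemma driven_path_has_integral:
  assumes "driven_path f x0 g S X" "0 \<le> s" "s \<le> t" "t \<le> S"
  shows "((\<lambda>r. f r (X r)) has_integral (X t - X s - (g t - g s))) {s..t}"
  using assms unfolding driven_path_def by blast

lemma driven_path_component_has_integral:
  assumes "driven_path f x0 g S X" "0 \<le> s" "s \<le> t" "t \<le> S"
  shows "((\<lambda>r. f r (X r) \<bullet> e) has_integral (X t \<bullet> e - X s \<bullet> e - (g t - g s) \<bullet> e)) {s..t}"
  using has_integral_linear[OF driven_path_has_integral[OF assms] bounded_linear_inner_left[of e]]
  by (simp add: o_def inner_diff_left)

lemma driven_path_component_ge:
  assumes "driven_path f x0 g S X" "0 \<le> s" "s \<le> t" "t \<le> S"
    and "\<And>r. r \<in> {s..t} \<Longrightarrow> m \<le> f r (X r) \<bullet> e"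
  shows "m * (t - s) + (g t - g s) \<bullet> e \<le> X t \<bullet> e - X s \<bullet> e"
proof -
  have "((\<lambda>r. m) has_integral m * (t - s)) {s..t}"
    using has_integral_const_real[of m s t] assms by (simp add: mult.commute)
  from has_integral_le[OF this driven_path_component_has_integral[OF assms(1-4), of e] assms(5)]
  show ?thesis by simp
qed

text \<open>Serves in \<open>uniform_limit_paths\<close> for the short stretch before the final
  time, where only the speed of the paths is controlled.\<close>

lemma driven_path_increment_le:
  assumes path: "driven_path f x0 g S X" "0 \<le> s" "s \<le> t" "t \<le> S"
    and speed: "\<And>r. r \<in> {s..t} \<Longrightarrow> norm (f r (X r)) \<le> m"
    and noise: "\<And>r. r \<in> {0..S} \<Longrightarrow> norm (g r) \<le> G"
  shows "norm (X t - X s) \<le> m * (t - s) + 2 * G"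
proof -
  have "norm (X t - X s - (g t - g s)) \<le> m * measure lborel (cbox s t)"
    using driven_path_has_integral[OF path] speed path
    by (intro has_integral_bound[where f = "\<lambda>r. f r (X r)"])
      (auto intro: order_trans[OF norm_ge_zero speed])
  moreover have "norm (X t - X s) \<le> norm (X t - X s - (g t - g s)) + (norm (g t) + norm (g s))"
    using norm_triangle_ineq[of "X t - X s - (g t - g s)" "g t - g s"] norm_triangle_ineq4[of "g t" "g s"]
    by simp
  moreover have "norm (g t) \<le> G" "norm (g s) \<le> G" using noise path by auto
  ultimately show ?thesis using path by simp
qed

text \<open>Gronwall for the distance from \<open>x0\<close>. The noise enters only through
  \<open>G\<close>, so constants drawn from the bound do not depend on the individual path.\<close>

lemma driven_path_growth:
  assumes path: "driven_path f x0 g S X" and L: "0 \<le> L" and B: "0 \<le> B"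
    and growth: "\<And>r x. r \<in> {0..S} \<Longrightarrow> norm (f r x) \<le> B + L * norm (x - x0)"
    and noise: "\<And>r. r \<in> {0..S} \<Longrightarrow> norm (g r) \<le> G" and g0: "g 0 = 0"
    and t: "t \<in> {0..S}"
  shows "norm (X t - x0) \<le> (B * t + G) * exp (L * t)"
proof -
  have cont: "continuous_on {0..t} (\<lambda>r. norm (X r - x0))"
    using path t unfolding driven_path_def by (auto intro!: continuous_intros elim: continuous_on_subset)
  have "norm (X s - x0) \<le> (B * t + G) + L * integral {0..s} (\<lambda>r. norm (X r - x0))"
    if s: "s \<in> {0..t}" for s
  proof -
    have int: "(\<lambda>r. norm (X r - x0)) integrable_on {0..s}"
      using s by (intro integrable_continuous_real continuous_on_subset[OF cont]) auto
    have h: "((\<lambda>r. f r (X r)) has_integral (X s - x0 - g s)) {0..s}"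
      using driven_path_has_integral[OF path, of 0 s] s t path g0 by (auto simp: driven_path_def)
    have "norm (integral {0..s} (\<lambda>r. f r (X r))) \<le> integral {0..s} (\<lambda>r. B + L * norm (X r - x0))"
      using h int s t
      by (intro integral_norm_bound_integral growth integrable_add integrable_on_mult_right) auto
    also have "\<dots> = B * s + L * integral {0..s} (\<lambda>r. norm (X r - x0))"
      using int s by (subst integral_add) (auto intro: integrable_on_mult_right)
    finally have "norm (X s - x0 - g s) \<le> B * s + L * integral {0..s} (\<lambda>r. norm (X r - x0))"
      using h by (simp add: integral_unique)
    moreover have "norm (X s - x0) \<le> norm (X s - x0 - g s) + norm (g s)"
      using norm_triangle_ineq[of "X s - x0 - g s" "g s"] by simp
    moreover have "norm (g s) \<le> G" using noise s t by auto
    moreover have "B * s \<le> B * t" using s B by (intro mult_left_mono) auto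
    ultimately show ?thesis by linarith
  qed
  from gronwall[OF cont L this, of t] t show ?thesis by simp
qed

text \<open>Gronwall for the difference, after replacing \<open>f\<close> by \<open>h\<close> along
  \<open>X\<close>. Agreement of the drifts is assumed on the open interval because the lemma is
  applied up to the first time at which \<open>X\<close> may be back on the hyperplane, where
  \<open>f\<close> and \<open>h\<close> can differ; endpoints do not change the integral.\<close>

lemma driven_path_comparison:
  assumes X: "driven_path f x0 g S X" and Z: "driven_path h x1 (\<lambda>_. 0) S Z" and L: "0 \<le> L"
    and lip: "\<And>r x y. r \<in> {a..b} \<Longrightarrow> norm (h r x - h r y) \<le> L * norm (x - y)"
    and eq: "\<And>r. r \<in> {a<..<b} \<Longrightarrow> f r (X r) = h r (X r)"
    and noise: "\<And>r. r \<in> {0..S} \<Longrightarrow> norm (g r) \<le> G"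
    and ab: "0 \<le> a" "b \<le> S" and t: "t \<in> {a..b}"
  shows "norm (X t - Z t) \<le> (norm (X a - Z a) + 2 * G) * exp (L * (t - a))"
proof -
  have cont: "continuous_on {a..b} (\<lambda>r. norm (X r - Z r))"
    using X Z ab unfolding driven_path_def by (auto intro!: continuous_intros elim: continuous_on_subset)
  have "norm (X s - Z s) \<le> (norm (X a - Z a) + 2 * G) + L * integral {a..s} (\<lambda>r. norm (X r - Z r))"
    if s: "s \<in> {a..b}" for s
  proof -
    have int: "(\<lambda>r. norm (X r - Z r)) integrable_on {a..s}"
      using s by (intro integrable_continuous_real continuous_on_subset[OF cont]) auto
    have "((\<lambda>r. f r (X r)) has_integral (X s - X a - (g s - g a))) (cbox a s)"
      using driven_path_has_integral[OF X, of a s] s ab by auto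
    then have "((\<lambda>r. h r (X r)) has_integral (X s - X a - (g s - g a))) (cbox a s)"
      by (rule has_integral_spike_interior) (use eq s in auto)
    from has_integral_diff[OF this] driven_path_has_integral[OF Z, of a s] s ab
    have h: "((\<lambda>r. h r (X r) - h r (Z r)) has_integral
        (X s - X a - (g s - g a) - (Z s - Z a))) {a..s}"
      by auto
    have "norm (integral {a..s} (\<lambda>r. h r (X r) - h r (Z r))) \<le> integral {a..s} (\<lambda>r. L * norm (X r - Z r))"
      using h int s by (intro integral_norm_bound_integral lip integrable_on_mult_right) auto
    then have "norm (X s - X a - (g s - g a) - (Z s - Z a)) \<le> L * integral {a..s} (\<lambda>r. norm (X r - Z r))"
      using h by (simp add: integral_unique)
    moreover have "norm (X s - Z s) \<le>
        norm (X s - X a - (g s - g a) - (Z s - Z a)) + norm ((X a - Z a) + (g s - g a))"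
      using norm_triangle_ineq[of "X s - X a - (g s - g a) - (Z s - Z a)" "(X a - Z a) + (g s - g a)"]
      by (simp add: algebra_simps)
    moreover have "norm ((X a - Z a) + (g s - g a)) \<le> norm (X a - Z a) + (norm (g s) + norm (g a))"
      using norm_triangle_ineq[of "X a - Z a" "g s - g a"] norm_triangle_ineq4[of "g s" "g a"] by simp
    moreover have "norm (g s) \<le> G" "norm (g a) \<le> G" using noise s ab by auto
    ultimately show ?thesis by linarith
  qed
  from gronwall[OF cont L this t] show ?thesis .
qed

section \<open>Sign changes of continuous functions\<close>

lemma last_zero:
  fixes y :: "real \<Rightarrow> real"
  assumes cont: "continuous_on {a..t} y" and a: "y a = 0" "a \<le> t" and t: "y t < 0"
  obtains u where "a \<le> u" "u \<le> t" "y u = 0" "\<And>s. u < s \<Longrightarrow> s \<le> t \<Longrightarrow> y s < 0"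
proof -
  have "closedin (top_of_set {a..t}) {s \<in> {a..t}. y s = 0}"
    by (rule continuous_closedin_preimage_constant[OF cont])
  then have "compact {s \<in> {a..t}. y s = 0}"
    by (rule closedin_compact[OF compact_Icc])
  moreover have "{s \<in> {a..t}. y s = 0} \<noteq> {}" using a by auto
  ultimately obtain u where u: "u \<in> {a..t}" "y u = 0"
    and max: "\<And>s. s \<in> {a..t} \<Longrightarrow> y s = 0 \<Longrightarrow> s \<le> u"
    using compact_attains_sup[of "{s \<in> {a..t}. y s = 0}"] by auto
  have "y s < 0" if s: "u < s" "s \<le> t" for s
  proof (rule ccontr)
    assume "\<not> y s < 0"
    then have "\<exists>r\<ge>s. r \<le> t \<and> y r = 0"
      using s t u by (intro IVT2' continuous_on_subset[OF cont]) auto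
    then obtain r where "s \<le> r" "r \<le> t" "y r = 0" by blast
    then show False using max[of r] s u by auto
  qed
  with u show ?thesis using that by auto
qed

text \<open>The part of \<open>{a..b}\<close> where \<open>y\<close> is nonpositive is compact and
  so has a least element. It is the exit time in the continuation argument of
  \<open>eventually_close_before\<close>.\<close>

lemma first_nonpos:
  fixes y :: "real \<Rightarrow> real"
  assumes cont: "continuous_on {a..b} y" and t: "t \<in> {a..b}" "y t \<le> 0"
  obtains u where "u \<in> {a..b}" "y u \<le> 0" "\<And>s. a \<le> s \<Longrightarrow> s < u \<Longrightarrow> 0 < y s"
proof -
  have "closedin (top_of_set {a..b}) ({a..b} \<inter> y -` {..0})"
    by (rule continuous_closedin_preimage[OF cont closed_atMost])
  then have "compact ({a..b} \<inter> y -` {..0})"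
    by (rule closedin_compact[OF compact_Icc])
  moreover have "{a..b} \<inter> y -` {..0} \<noteq> {}" using t by auto
  ultimately obtain u where "u \<in> {a..b} \<inter> y -` {..0}"
    and "\<forall>s \<in> {a..b} \<inter> y -` {..0}. u \<le> s"
    using compact_attains_inf by blast
  then have u: "u \<in> {a..b}" "y u \<le> 0"
    and min: "\<And>s. s \<in> {a..b} \<Longrightarrow> y s \<le> 0 \<Longrightarrow> u \<le> s" by auto
  have "0 < y s" if "a \<le> s" "s < u" for s
    using min[of s] that u by (cases "y s \<le> 0") auto
  with u show ?thesis using that by auto
qed


section \<open>Leaving the hyperplane transversally\<close>

text \<open>Here \<open>f\<close> is the glued drift and \<open>b\<close> the drift of the
  half-space that is entered. The last inequality of \<open>params\<close> keeps noiseless paths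
  strictly within \<open>\<delta>\<close> of \<open>x0\<close> up to \<open>T\<close>, which leaves
  room for small noise. The form of \<open>not_repelled\<close> is what a Lipschitz condition yields
  from an inequality on the hyperplane alone.\<close>

locale transversal_flow =
  fixes e x0 :: "'v::euclidean_space" and f b :: "real \<Rightarrow> 'v \<Rightarrow> 'v" and L B c \<delta> T S :: real
  assumes normal: "norm e = 1" "x0 \<bullet> e = 0"
    and params: "0 \<le> L" "0 \<le> B" "0 < c" "0 < T" "T < S" "B * T * exp (L * T) < \<delta>"
    and growth_f: "t \<in> {0..S} \<Longrightarrow> norm (f t x) \<le> B + L * norm (x - x0)"
    and growth_b: "t \<in> {0..S} \<Longrightarrow> norm (b t x) \<le> B + L * norm (x - x0)"
    and lipschitz_b: "t \<in> {0..S} \<Longrightarrow> norm (b t x - b t y) \<le> L * norm (x - y)"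
    and f_eq_b: "0 < x \<bullet> e \<Longrightarrow> f t x = b t x"
    and transversal: "t \<in> {0..T} \<Longrightarrow> norm (x - x0) \<le> \<delta> \<Longrightarrow> c \<le> b t x \<bullet> e"
    and not_repelled: "t \<in> {0..T} \<Longrightarrow> norm (x - x0) \<le> \<delta> \<Longrightarrow> x \<bullet> e \<le> 0 \<Longrightarrow> L * (x \<bullet> e) \<le> f t x \<bullet> e"
begin

text \<open>The drift \<open>F\<close> is left open: the perturbed paths use it with
  \<open>f\<close>, the noiseless path with \<open>b\<close> and \<open>G = 0\<close>.\<close>

lemma near_start:
  assumes path: "driven_path F x0 g S X"
    and growth: "\<And>t x. t \<in> {0..S} \<Longrightarrow> norm (F t x) \<le> B + L * norm (x - x0)"
    and noise: "\<And>r. r \<in> {0..S} \<Longrightarrow> norm (g r) \<le> G" "g 0 = 0"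
    and small: "(B * T + G) * exp (L * T) \<le> \<delta>" and t: "t \<in> {0..T}"
  shows "norm (X t - x0) \<le> \<delta>"
proof -
  have "norm (X t - x0) \<le> (B * t + G) * exp (L * t)"
    using t params by (intro driven_path_growth[OF path _ _ growth noise]) auto
  moreover have "0 \<le> G" using noise(1)[of 0] noise(2) params by auto
  then have "(B * t + G) * exp (L * t) \<le> (B * T + G) * exp (L * T)"
    using t params by (intro mult_mono add_mono) (auto intro: mult_left_mono)
  ultimately show ?thesis using small by linarith
qed

text \<open>From the last zero \<open>u\<close> before \<open>t\<close> on, the depth
  \<open>- (X r \<bullet> e)\<close> grows at a rate of at most \<open>L\<close> times itself, up to
  a noise increment of at most \<open>2 * G\<close>; Gronwall closes the estimate.\<close>

lemma height_lower_bound: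
  assumes path: "driven_path f x0 g S X"
    and noise: "\<And>r. r \<in> {0..S} \<Longrightarrow> norm (g r) \<le> G" "g 0 = 0"
    and small: "(B * T + G) * exp (L * T) \<le> \<delta>" and t: "t \<in> {0..T}"
  shows "- (2 * G * exp (L * T)) \<le> X t \<bullet> e"
proof (cases "X t \<bullet> e < 0")
  case False
  moreover have "0 \<le> G" using noise(1)[of 0] noise(2) params by auto
  then have "0 \<le> 2 * G * exp (L * T)" by simp
  ultimately show ?thesis by linarith
next
  case True
  have cont: "continuous_on {0..T} (\<lambda>r. X r \<bullet> e)"
    using path params unfolding driven_path_def
    by (auto intro!: continuous_intros elim: continuous_on_subset)
  have "X 0 \<bullet> e = 0" using path normal noise by (simp add: driven_path_def)
  then obtain u where u: "0 \<le> u" "u \<le> t" "X u \<bullet> e = 0"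
    and neg: "\<And>s. u < s \<Longrightarrow> s \<le> t \<Longrightarrow> X s \<bullet> e < 0"
    using last_zero[of 0 t "\<lambda>r. X r \<bullet> e"] t True continuous_on_subset[OF cont, of "{0..t}"]
    by (metis atLeastAtMost_iff atLeastatMost_subset_iff order_refl)
  have cont': "continuous_on {u..t} (\<lambda>r. - (X r \<bullet> e))"
    using u t by (intro continuous_intros continuous_on_subset[OF cont]) auto
  have "- (X s \<bullet> e) \<le> 2 * G + L * integral {u..s} (\<lambda>r. - (X r \<bullet> e))" if s: "s \<in> {u..t}" for s
  proof -
    have "(\<lambda>r. - (X r \<bullet> e)) integrable_on {u..s}"
      using s by (intro integrable_continuous_real continuous_on_subset[OF cont']) auto
    then have "((\<lambda>r. - L * (- (X r \<bullet> e))) has_integral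
        (- L * integral {u..s} (\<lambda>r. - (X r \<bullet> e)))) {u..s}"
      by (intro has_integral_mult_right) (rule integrable_integral)
    moreover have "((\<lambda>r. f r (X r) \<bullet> e) has_integral
        (X s \<bullet> e - X u \<bullet> e - (g s - g u) \<bullet> e)) {u..s}"
      using s u t params by (intro driven_path_component_has_integral[OF path]) auto
    moreover have "- L * (- (X r \<bullet> e)) \<le> f r (X r) \<bullet> e" if r: "r \<in> {u..s}" for r
      using not_repelled[of r "X r"] near_start[OF path growth_f noise small, of r]
        neg[of r] r s u t by (cases "r = u") auto
    ultimately have "- L * integral {u..s} (\<lambda>r. - (X r \<bullet> e)) \<le> X s \<bullet> e - X u \<bullet> e - (g s - g u) \<bullet> e"
      by (rule has_integral_le) auto
    moreover have "- ((g s - g u) \<bullet> e) \<le> norm (g s - g u)"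
      using norm_cauchy_schwarz[of "- (g s - g u)" e] normal by (simp add: inner_diff_left norm_minus_commute)
    moreover have "norm (g s - g u) \<le> norm (g s) + norm (g u)" by (rule norm_triangle_ineq4)
    moreover have "norm (g s) \<le> G" "norm (g u) \<le> G" using noise s u t params by auto
    ultimately show ?thesis using u by simp
  qed
  from gronwall[OF cont' params(1) this, of t] u
  have "- (X t \<bullet> e) \<le> 2 * G * exp (L * (t - u))" by auto
  also have "\<dots> \<le> 2 * G * exp (L * T)"
  proof -
    have "0 \<le> G" using noise(1)[of 0] noise(2) params by auto
    moreover have "L * (t - u) \<le> L * T" using u t params by (intro mult_left_mono) auto
    ultimately show ?thesis by (intro mult_left_mono) auto
  qed
  finally show ?thesis by linarith
qed

text \<open>Strictly above the hyperplane the drift is at least \<open>c\<close>; elsewhere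
  \<open>not_repelled\<close> and the depth bound limit the downward drift to a multiple of the
  noise bound \<open>G\<close>.\<close>

lemma height_drift_lower_bound:
  assumes path: "driven_path f x0 g S X"
    and noise: "\<And>r. r \<in> {0..S} \<Longrightarrow> norm (g r) \<le> G" "g 0 = 0"
    and small: "(B * T + G) * exp (L * T) \<le> \<delta>"
    and st: "0 \<le> s" "s \<le> t" "t \<le> T"
  shows "(g t - g s) \<bullet> e - L * (2 * G * exp (L * T)) * (t - s) \<le> X t \<bullet> e - X s \<bullet> e"
proof -
  have "0 \<le> G" using noise(1)[of 0] noise(2) params by auto
  then have nonneg: "0 \<le> L * (2 * G * exp (L * T))" using params by simp
  have "- (L * (2 * G * exp (L * T))) \<le> f r (X r) \<bullet> e" if r: "r \<in> {s..t}" for r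
  proof (cases "0 < X r \<bullet> e")
    case True
    then have "c \<le> f r (X r) \<bullet> e"
      using transversal[of r "X r"] near_start[OF path growth_f noise small, of r] r st f_eq_b by auto
    then show ?thesis using nonneg params by linarith
  next
    case False
    have "L * - (2 * G * exp (L * T)) \<le> L * (X r \<bullet> e)"
      using height_lower_bound[OF path noise small, of r] r st params by (intro mult_left_mono) auto
    also have "\<dots> \<le> f r (X r) \<bullet> e"
      using not_repelled[of r "X r"] near_start[OF path growth_f noise small, of r] r st False by auto
    finally show ?thesis by simp
  qed
  from driven_path_component_ge[OF path _ _ _ this] st params show ?thesis by simp
qed

end

text \<open>The hypothesis \<open>oscillation\<close> rules out that the path lingers on the wrong side of the
  hyperplane, where the drift need not push it back.\<close>

locale transversal_noise = transversal_flow e x0 f b L B c \<delta> T S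
  for e x0 :: "'v::euclidean_space" and f b L B c \<delta> T S +
  fixes w :: "real \<Rightarrow> 'v" and W :: real and E :: "real set" and Y :: "real \<Rightarrow> real \<Rightarrow> 'v"
  assumes w_cont: "continuous_on {0..S} w" and w_0: "w 0 = 0"
    and w_bound: "t \<in> {0..S} \<Longrightarrow> norm (w t) \<le> W"
    and oscillation: "0 < \<eta> \<Longrightarrow> \<exists>t\<in>{0<..<\<eta>}. C * t < w t \<bullet> e"
    and E_pos: "E \<subseteq> {0<..}"
    and paths: "\<epsilon> \<in> E \<Longrightarrow> driven_path f x0 (\<lambda>t. \<epsilon> *\<^sub>R w t) S (Y \<epsilon>)"
begin

lemma W_nonneg: "0 \<le> W"
  using w_bound[of 0] params w_0 by auto

lemma noise_bound: "\<epsilon> \<in> E \<Longrightarrow> r \<in> {0..S} \<Longrightarrow> norm (\<epsilon> *\<^sub>R w r) \<le> \<epsilon> * W"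
  using E_pos w_bound[of r] by (auto intro!: mult_left_mono)

lemma eventually_E: "eventually (\<lambda>\<epsilon>. \<epsilon> \<in> E) (at 0 within E)"
  by (simp add: eventually_at_filter)

lemma eventually_noise_small:
  assumes "(C::real) < K"
  shows "eventually (\<lambda>\<epsilon>. C + D * \<epsilon> < K) (at 0 within E)"
proof -
  have "((\<lambda>\<epsilon>. C + D * \<epsilon>) \<longlongrightarrow> C + D * 0) (at 0 within E)"
    by (intro tendsto_intros)
  then show ?thesis using assms by (auto dest: order_tendstoD)
qed

lemma eventually_small:
  "eventually (\<lambda>\<epsilon>. (B * T + \<epsilon> * W) * exp (L * T) \<le> \<delta>) (at 0 within E)"
  using eventually_noise_small[OF params(6), of "W * exp (L * T)"]
  by eventually_elim (simp add: algebra_simps)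

lemma eventually_above:
  assumes \<eta>: "0 < \<eta>" "\<eta> < T"
  shows "eventually (\<lambda>\<epsilon>. \<forall>t\<in>{\<eta>..T}. 0 < Y \<epsilon> t \<bullet> e) (at 0 within E)"
proof -
  \<comment> \<open>With \<open>G = \<epsilon> * W\<close> the downward drift in
    \<open>height_drift_lower_bound\<close> has size \<open>\<epsilon> * C\<close>. Noise and
    adverse drift thus scale alike, and \<open>t1\<close> and \<open>t2\<close> can be chosen before
    \<open>\<epsilon>\<close>.\<close>
  define C where "C = L * (2 * W * exp (L * T))"
  have C: "0 \<le> C" using params W_nonneg by (simp add: C_def)
  obtain t1 where t1: "0 < t1" "t1 < \<eta>" "C * t1 < w t1 \<bullet> e"
    using oscillation[OF \<eta>(1), of C] by auto
  have "continuous_on {t1..\<eta>} (\<lambda>t. w t \<bullet> e - C * t)"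
    using w_cont t1 \<eta> params by (auto intro!: continuous_intros elim: continuous_on_subset)
  then have "((\<lambda>t. w t \<bullet> e - C * t) \<longlongrightarrow> w t1 \<bullet> e - C * t1) (at t1 within {t1..\<eta>})"
    using t1 by (auto simp: continuous_on_def)
  from order_tendstoD(1)[OF this, of 0] t1
  have "eventually (\<lambda>t. 0 < w t \<bullet> e - C * t) (at t1 within {t1..\<eta>})"
    by simp
  then obtain h where h: "0 < h"
    and pos: "\<And>t. t \<in> {t1..\<eta>} \<Longrightarrow> t \<noteq> t1 \<Longrightarrow> dist t t1 < h \<Longrightarrow> 0 < w t \<bullet> e - C * t"
    unfolding eventually_at by blast
  define t2 where "t2 = min \<eta> (t1 + h / 2)"
  have t2: "t1 < t2" "t2 \<le> \<eta>" using t1 h by (auto simp: t2_def)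
  have w_above: "C * t < w t \<bullet> e" if "t \<in> {t1..t2}" for t
    using pos[of t] that t1 h by (cases "t = t1") (auto simp: t2_def dist_real_def)
  \<comment> \<open>The height that the transversal drift gains on \<open>{t1..t2}\<close>, where
    the path is above the hyperplane.\<close>
  define k where "k = c * (t2 - t1)"
  have "0 < k" using t2 params by (simp add: k_def)
  \<comment> \<open>The coefficient of \<open>\<epsilon>\<close> covers all that noise and downward
    drift can take away between \<open>t1\<close> and any later time up to \<open>T\<close>.\<close>
  have "eventually (\<lambda>\<epsilon>. - k + (4 * W + C * T + 2 * W * exp (L * T)) * \<epsilon> < 0) (at 0 within E)"
    using \<open>0 < k\<close> by (intro eventually_noise_small) auto
  with eventually_small eventually_E show ?thesis
  proof eventually_elim
    case (elim \<epsilon>)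
    then have \<epsilon>: "0 < \<epsilon>" "\<epsilon> \<in> E" using E_pos by auto
    note path = paths[OF \<epsilon>(2)]
    have noise: "\<And>r. r \<in> {0..S} \<Longrightarrow> norm (\<epsilon> *\<^sub>R w r) \<le> \<epsilon> * W" "\<epsilon> *\<^sub>R w 0 = 0"
      using noise_bound[OF \<epsilon>(2)] w_0 by auto
    note near = near_start[OF path growth_f noise elim(1)]
    have drift: "\<epsilon> * (w t \<bullet> e) - \<epsilon> * (w s \<bullet> e) - \<epsilon> * C * (t - s) \<le> Y \<epsilon> t \<bullet> e - Y \<epsilon> s \<bullet> e"
      if "0 \<le> s" "s \<le> t" "t \<le> T" for s t
      using height_drift_lower_bound[OF path noise elim(1) that]
      by (simp add: C_def inner_diff_left algebra_simps)
    have w_e: "\<bar>w r \<bullet> e\<bar> \<le> W" if "r \<in> {0..S}" for r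
      using Cauchy_Schwarz_ineq2[of "w r" e] normal w_bound[OF that] by simp
    have Y0: "Y \<epsilon> 0 \<bullet> e = 0" using path normal w_0 by (simp add: driven_path_def)
    have above: "0 < Y \<epsilon> r \<bullet> e" if r: "r \<in> {t1..t2}" for r
    proof -
      have "0 < \<epsilon> * (w r \<bullet> e - C * r)" using w_above[OF r] \<epsilon> by simp
      also have "\<dots> \<le> Y \<epsilon> r \<bullet> e"
        using drift[of 0 r] Y0 r t1 t2 \<eta> w_0 by (simp add: algebra_simps)
      finally show ?thesis .
    qed
    have "k + (\<epsilon> *\<^sub>R w t2 - \<epsilon> *\<^sub>R w t1) \<bullet> e \<le> Y \<epsilon> t2 \<bullet> e - Y \<epsilon> t1 \<bullet> e"
      unfolding k_def
    proof (rule driven_path_component_ge[OF path])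
      fix r assume r: "r \<in> {t1..t2}"
      show "c \<le> f r (Y \<epsilon> r) \<bullet> e"
        using f_eq_b[OF above[OF r]] transversal[of r "Y \<epsilon> r"] near[of r] r t1 t2 \<eta> by auto
    qed (use t1 t2 \<eta> params in auto)
    then have up: "k + \<epsilon> * (w t2 \<bullet> e) - \<epsilon> * (w t1 \<bullet> e) \<le> Y \<epsilon> t2 \<bullet> e - Y \<epsilon> t1 \<bullet> e"
      by (simp add: inner_diff_left)
    show ?case
    proof
      fix t assume t: "t \<in> {\<eta>..T}"
      have "\<epsilon> * C * (t - t2) \<le> \<epsilon> * C * T"
        using t t1 t2 \<epsilon> C by (intro mult_left_mono) auto
      moreover have "\<epsilon> * - W \<le> \<epsilon> * (w t \<bullet> e)"
        using w_e[of t] t t1 t2 \<eta> params \<epsilon> by (intro mult_left_mono) (auto simp: abs_le_iff)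
      moreover have "\<epsilon> * (w t1 \<bullet> e) \<le> \<epsilon> * W"
        using w_e[of t1] t1 \<eta> params \<epsilon> by (intro mult_left_mono) (auto simp: abs_le_iff)
      moreover have "0 < Y \<epsilon> t1 \<bullet> e" using above[of t1] t2 by simp
      moreover have "0 \<le> \<epsilon> * W" "0 \<le> \<epsilon> * (W * exp (L * T))" using \<epsilon> W_nonneg by auto
      ultimately show "0 < Y \<epsilon> t \<bullet> e"
        using up drift[of t2 t] t t1 t2 elim(3) by (simp add: algebra_simps)
    qed
  qed
qed

end

section \<open>Convergence to the noiseless path\<close>

locale transversal_limit = transversal_noise e x0 f b L B c \<delta> T S w W E Y
  for e x0 :: "'v::euclidean_space" and f b L B c \<delta> T S w W E Y +
  fixes Z :: "real \<Rightarrow> 'v"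
  assumes Z_path: "driven_path b x0 (\<lambda>_. 0) S Z"
    and Z_off: "t \<in> {0<..<S} \<Longrightarrow> Z t \<bullet> e \<noteq> 0"
begin

text \<open>Up to \<open>T\<close> the transversal drift makes the height positive; afterwards a
  change of sign would need a zero, which \<open>Z_off\<close> excludes.\<close>

lemma Z_above:
  assumes t: "t \<in> {0<..<S}"
  shows "0 < Z t \<bullet> e"
proof -
  have start: "0 < Z s \<bullet> e" if s: "s \<in> {0<..T}" for s
  proof -
    have "c * (s - 0) + (0 - 0) \<bullet> e \<le> Z s \<bullet> e - Z 0 \<bullet> e"
    proof (rule driven_path_component_ge[OF Z_path])
      fix r assume r: "r \<in> {0..s}"
      show "c \<le> b r (Z r) \<bullet> e"
        using near_start[OF Z_path growth_b, of 0 r] params r s by (intro transversal) auto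
    qed (use s params in auto)
    moreover have "Z 0 \<bullet> e = 0" using Z_path normal by (simp add: driven_path_def)
    moreover have "0 < c * s" using s params by simp
    ultimately show ?thesis by simp
  qed
  show ?thesis
  proof (rule ccontr)
    assume "\<not> 0 < Z t \<bullet> e"
    then have neg: "Z t \<bullet> e \<le> 0" "T < t" using start[of t] t by (auto simp: not_less intro: ccontr)
    moreover have "continuous_on {T..t} (\<lambda>r. Z r \<bullet> e)"
      using Z_path t params unfolding driven_path_def
      by (auto intro!: continuous_intros elim: continuous_on_subset)
    ultimately have "\<exists>r\<ge>T. r \<le> t \<and> Z r \<bullet> e = 0"
      using start[of T] params by (intro IVT2') auto
    then show False using Z_off t params by force
  qed
qed

text \<open>A continuation argument: while \<open>Y \<epsilon>\<close> stays above the hyperplane it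
  has the drift of \<open>Z\<close>, so Gronwall keeps it closer to \<open>Z\<close> than the least
  height of \<open>Z\<close> on \<open>{T..R}\<close>, and it cannot come back.\<close>

lemma eventually_close_before:
  assumes R: "T \<le> R" "R < S" and \<kappa>: "0 < \<kappa>"
  shows "eventually (\<lambda>\<epsilon>. \<forall>t\<in>{0..R}. norm (Y \<epsilon> t - Z t) \<le> \<kappa>) (at 0 within E)"
proof -
  have "continuous_on {T..R} (\<lambda>r. Z r \<bullet> e)"
    using Z_path R params unfolding driven_path_def
    by (auto intro!: continuous_intros elim: continuous_on_subset)
  from continuous_attains_inf[OF compact_Icc _ this] R obtain r0
    where r0: "r0 \<in> {T..R}" "\<And>t. t \<in> {T..R} \<Longrightarrow> Z r0 \<bullet> e \<le> Z t \<bullet> e"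
    by auto
  define m where "m = Z r0 \<bullet> e"
  have m: "0 < m" using Z_above[of r0] r0 R params by (simp add: m_def)
  define \<kappa>' where "\<kappa>' = min \<kappa> (m / 2)"
  have \<kappa>': "0 < \<kappa>'" "\<kappa>' \<le> \<kappa>" "\<kappa>' < m" using \<kappa> m by (auto simp: \<kappa>'_def)
  define D where "D = exp (L * S)"
  have D: "1 \<le> D" using params by (simp add: D_def)
  have exp_D: "exp (L * t) \<le> D" if "t \<le> S" for t
    using that params by (auto simp: D_def intro: mult_left_mono)
  \<comment> \<open>Chosen so that the discrepancy \<open>2 * B * \<eta> * D\<close> of the initial
    phase, enlarged by a further Gronwall factor \<open>D\<close>, stays strictly below
    \<open>\<kappa>'\<close>; the summand 1 gives strictness and a nonzero denominator.\<close>
  define \<eta> where "\<eta> = min (T / 2) (\<kappa>' / (2 * B * D * D + 1))"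
  have BD: "0 \<le> 2 * B * D * D" using params D by simp
  then have \<eta>: "0 < \<eta>" "\<eta> < T" using \<kappa>' params by (auto simp: \<eta>_def intro!: divide_pos_pos add_nonneg_pos)
  have "\<eta> * (2 * B * D * D + 1) \<le> \<kappa>'"
    using BD by (simp add: \<eta>_def flip: pos_le_divide_eq)
  then have "2 * B * \<eta> * D * D < \<kappa>'"
    using \<eta> by (simp add: algebra_simps)
  \<comment> \<open>This is the coefficient of \<open>\<epsilon>\<close> in the Gronwall bound
    \<open>((2 * B * \<eta> + \<epsilon> * W) * D + 2 * (\<epsilon> * W)) * D\<close> of
    \<open>late\<close>.\<close>
  from eventually_noise_small[OF this, of "W * D * D + 2 * W * D"]
    eventually_above[OF \<eta>] eventually_E
  show ?thesis
  proof eventually_elim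
    case (elim \<epsilon>)
    then have \<epsilon>: "0 < \<epsilon>" "\<epsilon> \<in> E" using E_pos by auto
    note path = paths[OF \<epsilon>(2)]
    have \<epsilon>W: "0 \<le> \<epsilon> * W" using \<epsilon> W_nonneg by simp
    have noise: "\<And>r. r \<in> {0..S} \<Longrightarrow> norm (\<epsilon> *\<^sub>R w r) \<le> \<epsilon> * W" "\<epsilon> *\<^sub>R w 0 = 0"
      using noise_bound[OF \<epsilon>(2)] w_0 by auto
    \<comment> \<open>In the initial phase the drifts may differ, so each path is compared with
      \<open>x0\<close> instead.\<close>
    have early: "norm (Y \<epsilon> t - Z t) \<le> (2 * B * \<eta> + \<epsilon> * W) * D" if t: "t \<in> {0..\<eta>}" for t
    proof -
      have "norm (Y \<epsilon> t - x0) \<le> (B * t + \<epsilon> * W) * exp (L * t)"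
        using t \<eta> params by (intro driven_path_growth[OF path _ _ growth_f noise]) auto
      also have "\<dots> \<le> (B * \<eta> + \<epsilon> * W) * D"
        using t \<eta> params exp_D[of t] \<epsilon> W_nonneg by (intro mult_mono add_mono) auto
      finally have 1: "norm (Y \<epsilon> t - x0) \<le> (B * \<eta> + \<epsilon> * W) * D" .
      have "norm (Z t - x0) \<le> (B * t + 0) * exp (L * t)"
        using t \<eta> params by (intro driven_path_growth[OF Z_path _ _ growth_b]) auto
      also have "\<dots> \<le> (B * \<eta>) * D"
        using t \<eta> params exp_D[of t] by (intro mult_mono) (auto intro: mult_left_mono)
      finally show ?thesis
        using 1 norm_triangle_ineq4[of "Y \<epsilon> t - x0" "Z t - x0"] by (simp add: algebra_simps)
    qed
    have "(2 * B * \<eta> + \<epsilon> * W) * D * 1 \<le> (2 * B * \<eta> + \<epsilon> * W) * D * D"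
      using D \<epsilon>W \<eta> params by (intro mult_left_mono) auto
    moreover have "0 \<le> \<epsilon> * W * D" using \<epsilon>W D by simp
    ultimately have early': "norm (Y \<epsilon> t - Z t) \<le> \<kappa>'" if t: "t \<in> {0..\<eta>}" for t
      using early[OF t] elim(1) by (simp add: algebra_simps)
    \<comment> \<open>The time \<open>v\<close> is either \<open>R\<close> or, in the proof of
      \<open>up\<close>, the first time at which the path is not above the hyperplane; positivity is
      therefore required strictly before \<open>v\<close>.\<close>
    have late: "norm (Y \<epsilon> t - Z t) \<le> \<kappa>'"
      if v: "v \<in> {\<eta>..R}" and t: "t \<in> {\<eta>..v}"
        and up: "\<And>r. \<eta> \<le> r \<Longrightarrow> r < v \<Longrightarrow> 0 < Y \<epsilon> r \<bullet> e" for t v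
    proof -
      have "norm (Y \<epsilon> t - Z t) \<le> (norm (Y \<epsilon> \<eta> - Z \<eta>) + 2 * (\<epsilon> * W)) * exp (L * (t - \<eta>))"
        using t v \<eta> R
        by (intro driven_path_comparison[where a = \<eta> and b = v,
              OF path Z_path params(1) lipschitz_b f_eq_b[OF up] noise(1)]) auto
      also have "\<dots> \<le> ((2 * B * \<eta> + \<epsilon> * W) * D + 2 * (\<epsilon> * W)) * D"
        using t v \<eta> R early[of \<eta>] exp_D[of "t - \<eta>"] \<epsilon> W_nonneg D params
        by (intro mult_mono add_mono) auto
      also have "\<dots> \<le> \<kappa>'" using elim(1) by (simp add: algebra_simps)
      finally show ?thesis .
    qed
    have up: "0 < Y \<epsilon> t \<bullet> e" if t: "t \<in> {\<eta>..R}" for t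
    proof (rule ccontr)
      assume "\<not> 0 < Y \<epsilon> t \<bullet> e"
      moreover have "continuous_on {\<eta>..R} (\<lambda>r. Y \<epsilon> r \<bullet> e)"
        using path R \<eta> unfolding driven_path_def
        by (auto intro!: continuous_intros elim: continuous_on_subset)
      ultimately obtain u where u: "u \<in> {\<eta>..R}" "Y \<epsilon> u \<bullet> e \<le> 0"
        and before: "\<And>s. \<eta> \<le> s \<Longrightarrow> s < u \<Longrightarrow> 0 < Y \<epsilon> s \<bullet> e"
        using first_nonpos[of \<eta> R "\<lambda>r. Y \<epsilon> r \<bullet> e" t] t by (auto simp: not_less)
      \<comment> \<open>By \<open>eventually_above\<close> there is no return up to
        \<open>T\<close>, so \<open>u\<close> lies where the height of \<open>Z\<close> is at least
        \<open>m\<close>.\<close>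
      then have "T < u" using elim(2) by force
      have "(Z u - Y \<epsilon> u) \<bullet> e \<le> norm (Y \<epsilon> u - Z u)"
        using norm_cauchy_schwarz[of "Z u - Y \<epsilon> u" e] normal by (simp add: norm_minus_commute)
      also have "\<dots> \<le> \<kappa>'" using u by (intro late[OF u(1) _ before]) auto
      also have "\<dots> < Z u \<bullet> e" using r0(2)[of u] \<open>T < u\<close> u \<kappa>' by (simp add: m_def)
      finally show False using u by (simp add: inner_diff_left)
    qed
    show ?case
    proof
      fix t assume t: "t \<in> {0..R}"
      show "norm (Y \<epsilon> t - Z t) \<le> \<kappa>"
        using early'[of t] late[of R t] up t \<eta> R \<kappa>' by (cases "t \<le> \<eta>") force+
    qed
  qed
qed

text \<open>At time \<open>S\<close> the path \<open>Z\<close> may be back on the hyperplane, so the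
  comparison stops at some \<open>R < S\<close>. After \<open>R\<close> both drifts are bounded by
  \<open>V\<close>, and \<open>R\<close> is close enough to \<open>S\<close> for that motion to be
  small.\<close>

lemma uniform_limit_paths: "uniform_limit {0..S} Y Z (at 0 within E)"
proof (rule uniform_limitI)
  fix \<kappa> :: real assume \<kappa>: "0 < \<kappa>"
  \<comment> \<open>For \<open>\<epsilon> < 1\<close> the noise is bounded by \<open>W\<close>, so
    \<open>K\<close> bounds the distance of the paths from \<open>x0\<close>, and \<open>V\<close>
    their drifts.\<close>
  define K where "K = (B * S + W) * exp (L * S)"
  define V where "V = B + L * K"
  have "0 \<le> K" using params W_nonneg by (simp add: K_def)
  then have V: "0 \<le> V" using params by (simp add: V_def)
  \<comment> \<open>The final drifts contribute at most
    \<open>V * \<theta> \<le> \<kappa> / 8\<close> each; adding \<open>\<kappa> / 4\<close> for the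
    noise and \<open>\<kappa> / 4\<close> at time \<open>R\<close> stays below
    \<open>\<kappa>\<close>.\<close>
  define \<theta> where "\<theta> = min (S - T) (\<kappa> / (8 * (V + 1)))"
  have \<theta>: "0 < \<theta>" "\<theta> \<le> S - T" using params \<kappa> V by (auto simp: \<theta>_def)
  have "\<theta> * (8 * (V + 1)) \<le> \<kappa>"
    using V by (simp add: \<theta>_def flip: pos_le_divide_eq)
  then have V\<theta>: "8 * (V * \<theta>) \<le> \<kappa>" using \<theta> by (simp add: algebra_simps)
  define R where "R = S - \<theta>"
  have R: "T \<le> R" "R < S" using \<theta> by (auto simp: R_def)
  have "eventually (\<lambda>\<epsilon>. 0 + 1 * \<epsilon> < (1::real)) (at 0 within E)"
    by (intro eventually_noise_small) auto
  moreover have "eventually (\<lambda>\<epsilon>. 0 + 2 * W * \<epsilon> < \<kappa> / 4) (at 0 within E)"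
    using \<kappa> by (intro eventually_noise_small) auto
  moreover have "eventually (\<lambda>\<epsilon>. \<forall>t\<in>{0..R}. norm (Y \<epsilon> t - Z t) \<le> \<kappa> / 4) (at 0 within E)"
    using \<kappa> by (intro eventually_close_before R) auto
  ultimately show "eventually (\<lambda>\<epsilon>. \<forall>t\<in>{0..S}. dist (Y \<epsilon> t) (Z t) < \<kappa>) (at 0 within E)"
    using eventually_E
  proof eventually_elim
    case (elim \<epsilon>)
    then have \<epsilon>: "0 < \<epsilon>" "\<epsilon> < 1" "\<epsilon> \<in> E" using E_pos by auto
    note path = paths[OF \<epsilon>(3)]
    have \<epsilon>W: "0 \<le> \<epsilon> * W" "\<epsilon> * W \<le> W"
      using \<epsilon> W_nonneg by (auto intro: mult_left_le_one_le)
    have noise: "\<And>r. r \<in> {0..S} \<Longrightarrow> norm (\<epsilon> *\<^sub>R w r) \<le> \<epsilon> * W" "\<epsilon> *\<^sub>R w 0 = 0"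
      using noise_bound[OF \<epsilon>(3)] w_0 by auto
    have grow_K: "(B * t + G) * exp (L * t) \<le> K" if "t \<in> {0..S}" "0 \<le> G" "G \<le> W" for t G
      unfolding K_def using that params W_nonneg
      by (intro mult_mono add_mono) (auto intro: mult_left_mono)
    have speed_Y: "norm (f t (Y \<epsilon> t)) \<le> V" if t: "t \<in> {0..S}" for t
    proof -
      have "norm (Y \<epsilon> t - x0) \<le> K"
        using driven_path_growth[OF path _ _ growth_f noise t] grow_K[OF t \<epsilon>W] params by simp
      then have "L * norm (Y \<epsilon> t - x0) \<le> L * K" using params by (intro mult_left_mono) auto
      then show ?thesis using growth_f[OF t, of "Y \<epsilon> t"] by (simp add: V_def)
    qed
    have speed_Z: "norm (b t (Z t)) \<le> V" if t: "t \<in> {0..S}" for t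
    proof -
      have "norm (Z t - x0) \<le> K"
        using driven_path_growth[OF Z_path _ _ growth_b _ _ t, of 0] grow_K[OF t, of 0] params W_nonneg
        by simp
      then have "L * norm (Z t - x0) \<le> L * K" using params by (intro mult_left_mono) auto
      then show ?thesis using growth_b[OF t, of "Z t"] by (simp add: V_def)
    qed
    show ?case
    proof
      fix t assume t: "t \<in> {0..S}"
      show "dist (Y \<epsilon> t) (Z t) < \<kappa>"
      proof (cases "t \<le> R")
        case True
        then have "norm (Y \<epsilon> t - Z t) \<le> \<kappa> / 4" using elim(3) t by simp
        then show ?thesis using \<kappa> by (simp add: dist_norm)
      next
        case False
        have "norm (Y \<epsilon> t - Y \<epsilon> R) \<le> V * (t - R) + 2 * (\<epsilon> * W)"
          using False t R params by (intro driven_path_increment_le[OF path _ _ _ speed_Y noise(1)]) auto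
        moreover have "norm (Z t - Z R) \<le> V * (t - R) + 2 * 0"
          using False t R params by (intro driven_path_increment_le[OF Z_path _ _ _ speed_Z]) auto
        moreover have "V * (t - R) \<le> V * \<theta>"
          using t V by (intro mult_left_mono) (auto simp: R_def)
        moreover have "norm (Y \<epsilon> R - Z R) \<le> \<kappa> / 4" using elim(3) R params by simp
        moreover have "norm (Y \<epsilon> t - Z t) \<le>
            norm (Y \<epsilon> t - Y \<epsilon> R) + norm (Y \<epsilon> R - Z R) + norm (Z t - Z R)"
          using norm_triangle_ineq[of "Y \<epsilon> t - Y \<epsilon> R" "(Y \<epsilon> R - Z R) - (Z t - Z R)"]
            norm_triangle_ineq4[of "Y \<epsilon> R - Z R" "Z t - Z R"]
          by simp
        ultimately show ?thesis using V\<theta> elim(2) \<kappa> by (simp add: dist_norm mult.commute)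
      qed
    qed
  qed
qed

end


section \<open>Small-time oscillation of the Wiener process\<close>

text \<open>If the half-line were null under this everywhere positive density, \<open>{1..2}\<close>
  would be Lebesgue null.\<close>

lemma std_normal_upper_tail_pos: "0 < measure (density lborel std_normal_density) {1..}"
proof -
  interpret N: prob_space "density lborel std_normal_density"
    by (rule prob_space_normal_density) simp
  have "emeasure (density lborel std_normal_density) {1..} \<noteq> 0"
  proof
    assume "emeasure (density lborel std_normal_density) {1..} = 0"
    then have "(\<integral>\<^sup>+x. ennreal (std_normal_density x) * indicator {1..} x \<partial>lborel) = 0"
      by (simp add: emeasure_density)
    then have "AE x in lborel. ennreal (std_normal_density x) * indicator {1..} x = 0"
      by (subst (asm) nn_integral_0_iff_AE) auto
    then have "AE x in lborel. x \<notin> {1..2::real}"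
    proof eventually_elim
      case (elim x)
      have "0 < std_normal_density x" by (rule normal_density_pos) simp
      with elim show ?case by (auto simp: indicator_def split: if_splits)
    qed
    then have "{1..2::real} \<in> null_sets lborel"
      by (subst AE_iff_null_sets) auto
    then show False by auto
  qed
  then show ?thesis by (simp add: N.emeasure_eq_measure zero_less_measure_iff)
qed

lemma (in prob_space) normal_upper_tail:
  assumes D: "distributed M lborel D (normal_density 0 \<sigma>)" and \<sigma>: "0 < \<sigma>"
  shows "prob {\<omega> \<in> space M. \<sigma> \<le> D \<omega>} = measure (density lborel std_normal_density) {1..}"
proof -
  have Z: "distributed M lborel (\<lambda>\<omega>. D \<omega> / \<sigma>) std_normal_density"
    using normal_standard_normal_convert[OF \<sigma>, of D 0] D by simp
  have "measure (density lborel std_normal_density) {1..} = measure (distr M lborel (\<lambda>\<omega>. D \<omega> / \<sigma>)) {1..}"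
    using distributed_distr_eq_density[OF Z] by simp
  also have "\<dots> = prob ((\<lambda>\<omega>. D \<omega> / \<sigma>) -` {1..} \<inter> space M)"
    using distributed_measurable[OF Z] by (intro measure_distr) auto
  also have "(\<lambda>\<omega>. D \<omega> / \<sigma>) -` {1..} \<inter> space M = {\<omega> \<in> space M. \<sigma> \<le> D \<omega>}"
    using \<sigma> by (auto simp: field_simps)
  finally show ?thesis ..
qed

lemma (in prob_space) normal_two_sided_tail_le:
  assumes D: "distributed M lborel D (normal_density 0 \<sigma>)" and pos: "0 < \<sigma>" "0 < a"
  shows "prob {\<omega> \<in> space M. a \<le> \<bar>D \<omega>\<bar>} \<le> \<sigma>\<^sup>2 / a\<^sup>2"
proof -
  have "random_variable borel D"
    using distributed_measurable[OF D] by simp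
  moreover have "integrable M (\<lambda>\<omega>. D \<omega> ^ 2)"
    using distributed_integrable[OF D, of "\<lambda>x. x ^ 2"] integrable_normal_moment[OF pos(1), of 0 2]
    by simp
  moreover have "expectation D = 0" "variance D = \<sigma>\<^sup>2"
    using normal_distributed_expectation[OF pos(1) D] normal_distributed_variance[OF pos(1) D] by auto
  ultimately show ?thesis
    using Chebyshev_inequality[of D a] pos by simp
qed

text \<open>Abstracts the height \<open>w \<bullet> e\<close> of the noise for either normal
  direction \<open>e\<close>, measured from its starting value \<open>v 0\<close>.\<close>

locale gaussian_increments = prob_space M for M :: "'a measure" +
  fixes v :: "real \<Rightarrow> 'a \<Rightarrow> real"
  assumes indep_increments: "0 \<le> u 0 \<Longrightarrow> (\<And>i. i < n \<Longrightarrow> u i \<le> u (Suc i)) \<Longrightarrow>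
      indep_vars (\<lambda>_. borel) (\<lambda>i \<omega>. v (u (Suc i)) \<omega> - v (u i) \<omega>) {..<n}"
    and normal_increments: "0 \<le> s \<Longrightarrow> s < t \<Longrightarrow>
      distributed M lborel (\<lambda>\<omega>. v t \<omega> - v s \<omega>) (normal_density 0 (sqrt (t - s)))"
begin

lemma increment_measurable [measurable]:
  "0 \<le> s \<Longrightarrow> s < t \<Longrightarrow> (\<lambda>\<omega>. v t \<omega> - v s \<omega>) \<in> borel_measurable M"
  using distributed_measurable[OF normal_increments] by simp

text \<open>Along a geometric sequence of times with small ratio the increments are independent
  and, up to a small probability, each dominates the value at its left endpoint; at least one of
  many increments exceeds its standard deviation, which is far larger than a multiple of the
  elapsed time.\<close>

lemma no_rise_small_probability:
  fixes C \<eta> \<iota> :: real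
  assumes \<eta>: "0 < \<eta>" and \<iota>: "0 < \<iota>"
  shows "\<exists>A\<in>events. {\<omega> \<in> space M. \<forall>t\<in>{0<..<\<eta>}. v t \<omega> - v 0 \<omega> \<le> C * t} \<subseteq> A \<and> prob A \<le> \<iota>"
proof -
  define p where "p = measure (density lborel std_normal_density) {1..}"
  have "0 < p" unfolding p_def by (rule std_normal_upper_tail_pos)
  \<comment> \<open>An increment stays below its standard deviation with probability
    \<open>1 - p\<close>; by independence all \<open>m\<close> of them do so with probability below
    \<open>\<iota> / 2\<close>.\<close>
  then obtain m where m: "(1 - p) ^ m < \<iota> / 2" "0 < m"
  proof -
    have "p \<le> 1"
      unfolding p_def
      by (intro prob_space.prob_le_1 prob_space_normal_density) simp
    with \<open>0 < p\<close> have "(\<lambda>m. (1 - p) ^ m) \<longlonglongrightarrow> 0" by (intro LIMSEQ_power_zero) auto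
    from order_tendstoD(2)[OF this, of "\<iota> / 2"] \<iota>
    have "eventually (\<lambda>m. (1 - p) ^ m < \<iota> / 2 \<and> 0 < m) sequentially"
      by (auto intro: eventually_conj eventually_gt_at_top)
    then show ?thesis using that by (auto simp: eventually_sequentially)
  qed
  \<comment> \<open>The \<open>m\<close> Chebyshev bounds \<open>8 * r\<close> below must sum to at
    most \<open>\<iota> / 2\<close>; \<open>r \<le> 1 / 2\<close> makes each increment carry at
    least half the variance of its right endpoint.\<close>
  define r where "r = min (1 / 2) (\<iota> / (16 * real m))"
  have r: "0 < r" "r \<le> 1 / 2" "real m * (8 * r) \<le> \<iota> / 2"
  proof -
    have "r \<le> \<iota> / (16 * real m)" by (simp add: r_def)
    then show "real m * (8 * r) \<le> \<iota> / 2" using m by (simp add: field_simps)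
  qed (use \<iota> m in \<open>auto simp: r_def\<close>)
  \<comment> \<open>The first term puts all times before \<open>\<eta>\<close>; the second makes
    \<open>2 * C * t\<close> at most the standard deviation of the increment ending at a chosen time
    \<open>t\<close>.\<close>
  define a where "a = min (\<eta> / 2) (1 / (8 * (C\<^sup>2 + 1)))"
  have a: "0 < a" "a < \<eta>" "4 * C\<^sup>2 * a \<le> 1 / 2"
  proof -
    have pos: "0 < C\<^sup>2 + 1" by (smt (verit) zero_le_power2)
    have "a \<le> 1 / (8 * (C\<^sup>2 + 1))" by (simp add: a_def)
    then have "a * (8 * (C\<^sup>2 + 1)) \<le> 1" using pos by (simp add: pos_le_divide_eq)
    moreover show "0 < a" using pos \<eta> by (simp add: a_def)
    ultimately show "4 * C\<^sup>2 * a \<le> 1 / 2" by (simp add: algebra_simps)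
  qed (use \<eta> in \<open>auto simp: a_def\<close>)
  \<comment> \<open>The times increase to \<open>\<tau> m = a\<close>, consecutive ones having ratio
    \<open>r\<close>.\<close>
  define \<tau> where "\<tau> = (\<lambda>i. a * r ^ (m - i))"
  define \<sigma> where "\<sigma> = (\<lambda>i. sqrt (\<tau> (Suc i) - \<tau> i))"
  define D where "D = (\<lambda>i \<omega>. v (\<tau> (Suc i)) \<omega> - v (\<tau> i) \<omega>)"
  have \<tau>_pos: "0 < \<tau> i" for i using a r by (simp add: \<tau>_def)
  have \<tau>_le: "\<tau> i \<le> a" for i using a r by (simp add: \<tau>_def power_le_one)
  have \<tau>_Suc: "\<tau> i = r * \<tau> (Suc i)" if "i < m" for i
    using that by (simp add: \<tau>_def flip: Suc_diff_Suc)
  have \<sigma>_sq: "(\<sigma> i)\<^sup>2 = \<tau> (Suc i) - \<tau> i" "\<tau> (Suc i) / 2 \<le> (\<sigma> i)\<^sup>2" "0 < \<sigma> i" "\<tau> i < \<tau> (Suc i)" if "i < m" for i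
  proof -
    have "r * \<tau> (Suc i) \<le> 1 / 2 * \<tau> (Suc i)"
      using r \<tau>_pos[of "Suc i"] by (intro mult_right_mono) auto
    then have "\<tau> (Suc i) / 2 \<le> \<tau> (Suc i) - \<tau> i" using \<tau>_Suc[OF that] by simp
    moreover from this show "\<tau> i < \<tau> (Suc i)" "0 < \<sigma> i"
      using \<tau>_pos[of "Suc i"] by (auto simp: \<sigma>_def)
    ultimately show "(\<sigma> i)\<^sup>2 = \<tau> (Suc i) - \<tau> i" "\<tau> (Suc i) / 2 \<le> (\<sigma> i)\<^sup>2"
      by (auto simp: \<sigma>_def)
  qed
  have normal_D: "distributed M lborel (D i) (normal_density 0 (\<sigma> i))" if "i < m" for i
    unfolding D_def \<sigma>_def using \<tau>_pos[of i] \<sigma>_sq(4)[OF that] by (intro normal_increments) auto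
  have [measurable]: "D i \<in> borel_measurable M" if "i < m" for i
    using distributed_measurable[OF normal_D[OF that]] by simp
  define A1 where "A1 = (\<Inter>i\<in>{..<m}. D i -` {..<\<sigma> i} \<inter> space M)"
  define A2 where "A2 = (\<Union>i\<in>{..<m}. {\<omega> \<in> space M. \<sigma> i / 2 \<le> \<bar>v (\<tau> i) \<omega> - v 0 \<omega>\<bar>})"
  have "prob A1 = (\<Prod>i\<in>{..<m}. prob (D i -` {..<\<sigma> i} \<inter> space M))"
    unfolding A1_def
  proof (rule indep_varsD_finite)
    show "indep_vars (\<lambda>_. borel) D {..<m}"
      unfolding D_def using \<tau>_pos[of 0] \<sigma>_sq(4) by (intro indep_increments) (auto intro: less_imp_le)
  qed (use m in auto)
  also have "\<dots> = (\<Prod>i\<in>{..<m}. 1 - p)"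
  proof (rule prod.cong)
    fix i assume i: "i \<in> {..<m}"
    then have [measurable]: "D i \<in> borel_measurable M" by simp
    have "D i -` {..<\<sigma> i} \<inter> space M = space M - {\<omega> \<in> space M. \<sigma> i \<le> D i \<omega>}" by auto
    moreover have "prob {\<omega> \<in> space M. \<sigma> i \<le> D i \<omega>} = p"
      unfolding p_def using i \<sigma>_sq(3) by (intro normal_upper_tail normal_D) auto
    ultimately show "prob (D i -` {..<\<sigma> i} \<inter> space M) = 1 - p" by (simp add: prob_compl)
  qed simp
  finally have A1: "prob A1 < \<iota> / 2" using m by simp
  have A2_events: "{\<omega> \<in> space M. \<sigma> i / 2 \<le> \<bar>v (\<tau> i) \<omega> - v 0 \<omega>\<bar>} \<in> events" for i
    using increment_measurable[of 0 "\<tau> i"] \<tau>_pos[of i] by measurable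
  have "prob A2 \<le> (\<Sum>i\<in>{..<m}. prob {\<omega> \<in> space M. \<sigma> i / 2 \<le> \<bar>v (\<tau> i) \<omega> - v 0 \<omega>\<bar>})"
    unfolding A2_def using A2_events by (intro finite_measure_subadditive_finite) auto
  also have "\<dots> \<le> (\<Sum>i\<in>{..<m}. 8 * r)"
  proof (rule sum_mono)
    fix i assume "i \<in> {..<m}"
    then have i: "i < m" by simp
    \<comment> \<open>Chebyshev with variance \<open>\<tau> i = r * \<tau> (Suc i)\<close>, against
      a squared threshold of at least \<open>\<tau> (Suc i) / 8\<close>.\<close>
    have "prob {\<omega> \<in> space M. \<sigma> i / 2 \<le> \<bar>v (\<tau> i) \<omega> - v 0 \<omega>\<bar>} \<le> (sqrt (\<tau> i - 0))\<^sup>2 / (\<sigma> i / 2)\<^sup>2"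
      using \<tau>_pos[of i] \<sigma>_sq[OF i] by (intro normal_two_sided_tail_le normal_increments) auto
    also have "\<dots> = 4 * (r * \<tau> (Suc i)) / (\<sigma> i)\<^sup>2"
      using \<tau>_pos[of i] \<tau>_Suc[OF i] by (simp add: power_divide)
    also have "\<dots> \<le> 4 * (r * \<tau> (Suc i)) / (\<tau> (Suc i) / 2)"
      using \<sigma>_sq[OF i] \<tau>_pos[of "Suc i"] r by (intro divide_left_mono) auto
    also have "\<dots> = 8 * r" using \<tau>_pos[of "Suc i"] by simp
    finally show "prob {\<omega> \<in> space M. \<sigma> i / 2 \<le> \<bar>v (\<tau> i) \<omega> - v 0 \<omega>\<bar>} \<le> 8 * r" .
  qed
  finally have A2: "prob A2 \<le> \<iota> / 2" using r by simp
  have A1_events: "A1 \<in> events" unfolding A1_def using m by (intro sets.finite_INT) auto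
  have A2_events': "A2 \<in> events" unfolding A2_def using A2_events by auto
  have "{\<omega> \<in> space M. \<forall>t\<in>{0<..<\<eta>}. v t \<omega> - v 0 \<omega> \<le> C * t} \<subseteq> A1 \<union> A2"
  proof (rule subsetI, rule ccontr)
    fix \<omega> assume \<omega>: "\<omega> \<in> {\<omega> \<in> space M. \<forall>t\<in>{0<..<\<eta>}. v t \<omega> - v 0 \<omega> \<le> C * t}" "\<omega> \<notin> A1 \<union> A2"
    \<comment> \<open>Outside \<open>A1\<close> some increment reaches \<open>\<sigma> i\<close>,
      and outside \<open>A2\<close> its left endpoint costs less than \<open>\<sigma> i / 2\<close>;
      what remains exceeds \<open>C * \<tau> (Suc i)\<close>.\<close>
    then obtain i where i: "i < m" "\<sigma> i \<le> D i \<omega>" using m by (auto simp: A1_def not_less split: if_splits)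
    have "\<bar>v (\<tau> i) \<omega> - v 0 \<omega>\<bar> < \<sigma> i / 2" using \<omega> i by (auto simp: A2_def not_le)
    then have "\<sigma> i / 2 < v (\<tau> (Suc i)) \<omega> - v 0 \<omega>" using i unfolding D_def by linarith
    moreover have "v (\<tau> (Suc i)) \<omega> - v 0 \<omega> \<le> C * \<tau> (Suc i)"
      using \<omega> \<tau>_pos[of "Suc i"] \<tau>_le[of "Suc i"] a by auto
    moreover have "2 * C * \<tau> (Suc i) \<le> \<sigma> i"
    proof (rule power2_le_imp_le)
      have "4 * C\<^sup>2 * \<tau> (Suc i) \<le> 4 * C\<^sup>2 * a" using \<tau>_le by (intro mult_left_mono) auto
      then have "4 * C\<^sup>2 * \<tau> (Suc i) * \<tau> (Suc i) \<le> 1 / 2 * \<tau> (Suc i)"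
        using a \<tau>_pos[of "Suc i"] by (intro mult_right_mono) auto
      then show "(2 * C * \<tau> (Suc i))\<^sup>2 \<le> (\<sigma> i)\<^sup>2"
        using \<sigma>_sq(2)[OF i(1)] by (simp add: power2_eq_square algebra_simps)
    qed (use \<sigma>_sq(3)[OF i(1)] in simp)
    ultimately show False by linarith
  qed
  moreover have "prob (A1 \<union> A2) \<le> \<iota>"
    using measure_Un_le[OF A1_events A2_events'] A1 A2 by simp
  moreover have "A1 \<union> A2 \<in> events"
    using A1_events A2_events' by (rule sets.Un)
  ultimately show ?thesis by blast
qed

text \<open>The exceptional set quantifies over uncountably many times, so it is covered by events
  of arbitrarily small probability, whose intersection is a null event.\<close>

lemma AE_rise:
  fixes C \<eta> :: real
  assumes \<eta>: "0 < \<eta>"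
  shows "AE \<omega> in M. \<exists>t\<in>{0<..<\<eta>}. C * t < v t \<omega> - v 0 \<omega>"
proof -
  let ?N = "{\<omega> \<in> space M. \<forall>t\<in>{0<..<\<eta>}. v t \<omega> - v 0 \<omega> \<le> C * t}"
  have "\<forall>n. \<exists>A. A \<in> events \<and> ?N \<subseteq> A \<and> prob A \<le> inverse (real (Suc n))"
  proof
    fix n :: nat
    have "0 < inverse (real (Suc n))" by simp
    from no_rise_small_probability[OF \<eta> this, of C]
    show "\<exists>A. A \<in> events \<and> ?N \<subseteq> A \<and> prob A \<le> inverse (real (Suc n))" by blast
  qed
  from choice[OF this] obtain A where A: "\<And>n. A n \<in> events" "\<And>n. prob (A n) \<le> inverse (real (Suc n))"
    and sub: "\<And>n. ?N \<subseteq> A n"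
    by blast
  have events: "(\<Inter>n. A n) \<in> events" using A by auto
  have "prob (\<Inter>n. A n) \<le> inverse (real (Suc n))" for n
    using A events by (intro order_trans[OF finite_measure_mono A(2)]) auto
  then have "prob (\<Inter>n. A n) \<le> 0"
    by (intro LIMSEQ_le_const[OF LIMSEQ_inverse_real_of_nat]) auto
  then have "(\<Inter>n. A n) \<in> null_sets M"
    using events by (auto simp: null_sets_def emeasure_eq_measure measure_le_0_iff)
  then show ?thesis by (rule AE_I') (use sub in \<open>auto simp: not_less\<close>)
qed

text \<open>Since \<open>t > 0\<close>, larger slopes and shorter intervals give stronger claims, so
  natural slopes and the bounds \<open>inverse (real (Suc n))\<close> suffice: countably many null
  sets.\<close>

lemma AE_oscillation:
  "AE \<omega> in M. \<forall>C. \<forall>\<eta>>0. \<exists>t\<in>{0<..<\<eta>}. C * t < v t \<omega> - v 0 \<omega>"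
proof -
  have "AE \<omega> in M. \<forall>k n. \<exists>t\<in>{0<..<inverse (real (Suc n))}. real k * t < v t \<omega> - v 0 \<omega>"
    by (simp only: AE_all_countable) (intro allI AE_rise, simp)
  then show ?thesis
  proof eventually_elim
    case (elim \<omega>)
    show ?case
    proof (intro allI impI)
      fix C \<eta> :: real assume "0 < \<eta>"
      then obtain n where n: "inverse (real (Suc n)) < \<eta>" using reals_Archimedean by blast
      obtain k where k: "C \<le> real k" using real_arch_simple by blast
      obtain t where t: "t \<in> {0<..<inverse (real (Suc n))}" "real k * t < v t \<omega> - v 0 \<omega>"
        using elim by blast
      have "C * t \<le> real k * t" using k t by (intro mult_right_mono) auto
      then have "C * t < v t \<omega> - v 0 \<omega>" using t by linarith
      moreover have "t \<in> {0<..<\<eta>}" using t n by auto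
      ultimately show "\<exists>t\<in>{0<..<\<eta>}. C * t < v t \<omega> - v 0 \<omega>" ..
    qed
  qed
qed

end


text \<open>A centred normal law is symmetric, so the coordinate and its negative both have the
  required increments; \<open>w 0 = 0\<close> almost surely removes the starting value.\<close>

lemma wiener_process_AE_oscillation:
  assumes w: "wiener_process M w" and s: "s = 1 \<or> s = - 1"
  shows "AE \<omega> in M. \<forall>C. \<forall>\<eta>>0. \<exists>t\<in>{0<..<\<eta>}. C * t < w t \<omega> \<bullet> (s *\<^sub>R axis d 1)"
proof -
  interpret prob_space M using w by (simp add: wiener_process_def)
  interpret gaussian_increments M "\<lambda>t \<omega>. s * w t \<omega> $ d"
  proof
    fix u :: "nat \<Rightarrow> real" and n :: nat
    assume "0 \<le> u 0" "\<And>i. i < n \<Longrightarrow> u i \<le> u (Suc i)"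
    then have "indep_vars (\<lambda>_. borel) (\<lambda>i \<omega>. w (u (Suc i)) \<omega> - w (u i) \<omega>) {..<n}"
      using w by (simp add: wiener_process_def)
    from indep_vars_compose2[OF this, of "\<lambda>_ x. s * x $ d" "\<lambda>_. borel"]
    show "indep_vars (\<lambda>_. borel) (\<lambda>i \<omega>. s * w (u (Suc i)) \<omega> $ d - s * w (u i) \<omega> $ d) {..<n}"
      by (simp add: right_diff_distrib)
  next
    fix r t :: real assume "0 \<le> r" "r < t"
    then have "distributed M lborel (\<lambda>\<omega>. (w t \<omega> - w r \<omega>) $ d) (normal_density 0 (sqrt (t - r)))"
      using w by (simp add: wiener_process_def)
    from normal_density_affine[OF this, of s 0] s \<open>r < t\<close>
    show "distributed M lborel (\<lambda>\<omega>. s * w t \<omega> $ d - s * w r \<omega> $ d) (normal_density 0 (sqrt (t - r)))"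
      by (auto simp: right_diff_distrib)
  qed
  have "AE \<omega> in M. w 0 \<omega> = 0" using w by (simp add: wiener_process_def)
  with AE_oscillation show ?thesis
    by eventually_elim (simp add: inner_axis)
qed

section \<open>Small-noise limit of the stopped solutions\<close>

lemma admissible_drift_lipschitz:
  assumes "admissible_drift f"
  obtains L where "0 \<le> L" "\<And>t x y. 0 \<le> t \<Longrightarrow> norm (f t x - f t y) \<le> L * norm (x - y)"
proof -
  obtain L where L: "\<forall>t\<ge>0. L-lipschitz_on UNIV (f t)"
    using assms unfolding admissible_drift_def by blast
  then have "0 \<le> L" using lipschitz_on_nonneg by blast
  then show ?thesis
    using L that by (auto simp: lipschitz_on_def dist_norm)
qed

text \<open>Compactness of \<open>{0..S}\<close> makes local boundedness near the points
  \<open>(t, x0)\<close> uniform. With the Lipschitz condition this yields linear growth.\<close>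

lemma admissible_drift_bounded:
  assumes "admissible_drift f"
  obtains B where "0 \<le> B" "\<And>t. t \<in> {0..S} \<Longrightarrow> norm (f t x0) \<le> B"
proof -
  have "\<forall>t\<in>{0..}. \<exists>r>0. bounded ((\<lambda>(s, y). f s y) ` (ball (t, x0) r \<inter> {0..} \<times> UNIV))"
    using assms unfolding admissible_drift_def by auto
  then obtain r where r: "\<And>t. 0 \<le> t \<Longrightarrow> 0 < r t"
    and bdd: "\<And>t. 0 \<le> t \<Longrightarrow> bounded ((\<lambda>(s, y). f s y) ` (ball (t, x0) (r t) \<inter> {0..} \<times> UNIV))"
    by (metis atLeast_iff)
  obtain C where C: "C \<subseteq> {0..S}" "finite C" "{0..S} \<subseteq> (\<Union>t\<in>C. ball t (r t))"
  proof (rule compactE_image[of "{0..S}" "{0..S}" "\<lambda>t. ball t (r t)"])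
    show "{0..S} \<subseteq> (\<Union>t\<in>{0..S}. ball t (r t))"
      using r by fastforce
  qed auto
  have "bounded (\<Union>t\<in>C. (\<lambda>(s, y). f s y) ` (ball (t, x0) (r t) \<inter> {0..} \<times> UNIV))"
    using C bdd by (intro bounded_UN) auto
  then obtain B where B: "0 < B"
    "\<And>z. z \<in> (\<Union>t\<in>C. (\<lambda>(s, y). f s y) ` (ball (t, x0) (r t) \<inter> {0..} \<times> UNIV)) \<Longrightarrow> norm z \<le> B"
    unfolding bounded_pos by blast
  have "norm (f s x0) \<le> B" if s: "s \<in> {0..S}" for s
  proof (rule B(2))
    obtain t where t: "t \<in> C" "s \<in> ball t (r t)" using C s by blast
    then have "(s, x0) \<in> ball (t, x0) (r t) \<inter> {0..} \<times> UNIV"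
      using s by (simp add: dist_Pair_Pair)
    with t(1) show "f s x0 \<in> (\<Union>t\<in>C. (\<lambda>(s, y). f s y) ` (ball (t, x0) (r t) \<inter> {0..} \<times> UNIV))"
      by (intro UN_I[OF t(1)]) (force simp: image_iff)
  qed
  then show ?thesis using B(1) that[of B] by simp
qed

text \<open>Passes from the Lebesgue to the gauge integral and from integrals starting at 0 to
  increments.\<close>

lemma driven_path_solves_integral_eq:
  assumes sol: "solves_integral_eq f x0 g I X" and S: "0 \<le> S" "{0..S} \<subseteq> I"
  shows "driven_path f x0 g S X"
  unfolding driven_path_def
proof (intro conjI allI impI)
  show "continuous_on {0..S} X"
    using sol S unfolding solves_integral_eq_def by (auto elim: continuous_on_subset)
  have int: "(\<lambda>r. f r (X r)) integrable_on {0..t}"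
    and eq: "X t = x0 + integral {0..t} (\<lambda>r. f r (X r)) + g t" if "t \<in> {0..S}" for t
  proof -
    have "set_integrable lborel {0..t} (\<lambda>r. f r (X r))"
      and "X t = x0 + (LBINT r:{0..t}. f r (X r)) + g t"
      using sol S that unfolding solves_integral_eq_def by auto
    then show "(\<lambda>r. f r (X r)) integrable_on {0..t}"
      and "X t = x0 + integral {0..t} (\<lambda>r. f r (X r)) + g t"
      using set_borel_integral_eq_integral by auto
  qed
  show "X 0 = x0 + g 0" using eq[of 0] S by simp
  fix s t assume st: "0 \<le> s" "s \<le> t" "t \<le> S"
  have "(\<lambda>r. f r (X r)) integrable_on {s..t}"
    using st by (intro integrable_on_subinterval[OF int[of t]]) auto
  moreover have "integral {s..t} (\<lambda>r. f r (X r)) = X t - X s - (g t - g s)"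
    using Henstock_Kurzweil_Integration.integral_combine[OF st(1,2) int[of t]] eq[of s] eq[of t] st
    by (simp add: algebra_simps)
  ultimately show "((\<lambda>r. f r (X r)) has_integral (X t - X s - (g t - g s))) {s..t}"
    by (metis integrable_integral)
qed

text \<open>The deterministic core, for one fixed noise path. It reduces to
  \<open>transversal_limit\<close> on a finite interval after the hypotheses near the hyperplane are
  extended to a full ball around \<open>x0\<close>.\<close>

lemma stopped_path_limit:
  fixes b b' f :: "real \<Rightarrow> real ^ 'n \<Rightarrow> real ^ 'n" and d :: "'n::finite"
  assumes b: "admissible_drift b" and b': "admissible_drift b'"
    and e: "norm e = 1" "hyperplane d = {x. x \<bullet> e = 0}" and x0: "x0 \<in> hyperplane d"
    and f: "\<And>t x. 0 < x \<bullet> e \<Longrightarrow> f t x = b t x" "\<And>t x. f t x = b t x \<or> f t x = b' t x"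
    and w: "continuous_on {0..} w" "w 0 = 0"
    and osc: "\<And>C \<eta>. 0 < \<eta> \<Longrightarrow> \<exists>t\<in>{0<..<\<eta>}. C * t < w t \<bullet> e"
    and E: "E \<subseteq> {0<..}"
    and Y: "\<And>\<epsilon>. \<epsilon> \<in> E \<Longrightarrow> solves_integral_eq f x0 (\<lambda>t. \<epsilon> *\<^sub>R w t) {0..} (Y \<epsilon>)"
    and Z: "solves_until_hitting d b x0 Z"
    and pos: "0 < T" "0 < \<delta>" "0 < c"
    and transversal: "\<And>t x. t \<in> {0..T} \<Longrightarrow> 0 < x \<bullet> e \<Longrightarrow> norm (x - x0) \<le> \<delta> \<Longrightarrow> c \<le> b t x \<bullet> e"
    and not_repelled: "\<And>t x. t \<in> {0..T} \<Longrightarrow> x \<bullet> e = 0 \<Longrightarrow> norm (x - x0) \<le> \<delta> \<Longrightarrow> 0 \<le> b' t x \<bullet> e"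
  shows "locally_uniform_limit (\<lambda>\<epsilon>. stopped (hitting_time d Z) (Y \<epsilon>))
           (stopped (hitting_time d Z) Z) (at 0 within E)"
  unfolding locally_uniform_limit_def
proof (intro allI impI)
  fix K :: "real set" assume K: "compact K" "K \<subseteq> {0..}"
  define \<tau> where "\<tau> = hitting_time d Z"
  have eventually_E: "eventually (\<lambda>\<epsilon>. \<epsilon> \<in> E) (at 0 within E)"
    by (simp add: eventually_at_filter)
  have \<tau>: "0 \<le> \<tau>" unfolding \<tau>_def hitting_time_def by (intro Inf_greatest) auto
  have x0_e: "x0 \<bullet> e = 0" using x0 e by auto
  have Z_sol: "solves_integral_eq b x0 (\<lambda>_. 0) {t. 0 \<le> t \<and> ereal t \<le> \<tau>} Z"
    using Z by (simp add: solves_until_hitting_def \<tau>_def)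
  have "uniform_limit K (\<lambda>\<epsilon>. stopped \<tau> (Y \<epsilon>)) (stopped \<tau> Z) (at 0 within E)"
  proof (cases "\<tau> = 0")
    \<comment> \<open>Here the equation constrains \<open>Z\<close> at time 0 only, and both stopped
      paths are constantly \<open>x0\<close>.\<close>
    case True
    have stopped_0: "stopped \<tau> V t = V 0" if "t \<in> K" for V :: "real \<Rightarrow> real ^ 'n" and t
      using that K True by (auto simp: stopped_def min_def zero_ereal_def)
    have "Z 0 = x0"
      using driven_path_solves_integral_eq[OF Z_sol, of 0] \<tau> by (simp add: driven_path_def zero_ereal_def)
    show ?thesis
    proof (rule uniform_limitI)
      fix \<kappa> :: real assume "0 < \<kappa>"
      from eventually_E show "eventually (\<lambda>\<epsilon>. \<forall>t\<in>K. dist (stopped \<tau> (Y \<epsilon>) t) (stopped \<tau> Z t) < \<kappa>) (at 0 within E)"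
      proof eventually_elim
        case (elim \<epsilon>)
        have "Y \<epsilon> 0 = x0"
          using driven_path_solves_integral_eq[OF Y[OF elim], of 0] w by (simp add: driven_path_def)
        then show ?case using stopped_0 \<open>Z 0 = x0\<close> \<open>0 < \<kappa>\<close> by simp
      qed
    qed
  next
    case False
    with \<tau> have "0 < \<tau>" by auto
    obtain R where R: "0 < R" "\<And>t. t \<in> K \<Longrightarrow> t \<le> R"
      using compact_imp_bounded[OF K(1)] unfolding bounded_pos by (metis abs_le_D1 real_norm_def)
    \<comment> \<open>Finite even if \<open>Z\<close> never hits the hyperplane. On \<open>K\<close>
      stopping amounts to evaluation at \<open>min t S\<close>, which leaves the interval
      \<open>{0..S}\<close>.\<close>
    define S where "S = real_of_ereal (min (ereal R) \<tau>)"
    have S_eq: "ereal S = min (ereal R) \<tau>"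
      using \<open>0 < \<tau>\<close> R unfolding S_def by (cases \<tau>) (auto simp: min_def)
    then have "0 < ereal S" "ereal S \<le> \<tau>" using \<open>0 < \<tau>\<close> R by (auto simp: min_def)
    then have S: "0 < S" "ereal S \<le> \<tau>" by auto
    have stopped_eq: "stopped \<tau> V t = V (min t S)" "min t S \<in> {0..S}"
      if "t \<in> K" for V :: "real \<Rightarrow> real ^ 'n" and t
    proof -
      have "t \<le> R" "0 \<le> t" using R K that by auto
      then have "min (ereal t) \<tau> = min (ereal t) (ereal S)"
        unfolding S_eq by (simp add: min_absorb1 flip: min.assoc)
      then show "stopped \<tau> V t = V (min t S)" by (auto simp: stopped_def min_def)
      show "min t S \<in> {0..S}" using S \<open>0 \<le> t\<close> by auto
    qed
    obtain L1 where L1: "0 \<le> L1" "\<And>t x y. 0 \<le> t \<Longrightarrow> norm (b t x - b t y) \<le> L1 * norm (x - y)"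
      using admissible_drift_lipschitz[OF b] by blast
    obtain L2 where L2: "0 \<le> L2" "\<And>t x y. 0 \<le> t \<Longrightarrow> norm (b' t x - b' t y) \<le> L2 * norm (x - y)"
      using admissible_drift_lipschitz[OF b'] by blast
    define L where "L = max L1 L2"
    have L: "0 \<le> L" using L1(1) by (simp add: L_def)
    have lip: "norm (b t x - b t y) \<le> L * norm (x - y)"
      and lip': "norm (b' t x - b' t y) \<le> L * norm (x - y)" if "0 \<le> t" for t x y
      using L1(2)[OF that, of x y] L2(2)[OF that, of x y]
        mult_right_mono[of L1 L "norm (x - y)"] mult_right_mono[of L2 L "norm (x - y)"]
      by (auto simp: L_def)
    obtain B1 where B1: "0 \<le> B1" "\<And>t. t \<in> {0..S} \<Longrightarrow> norm (b t x0) \<le> B1"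
      using admissible_drift_bounded[OF b] by blast
    obtain B2 where B2: "0 \<le> B2" "\<And>t. t \<in> {0..S} \<Longrightarrow> norm (b' t x0) \<le> B2"
      using admissible_drift_bounded[OF b'] by blast
    define B where "B = max B1 B2"
    have B: "0 \<le> B" using B1(1) by (simp add: B_def)
    have growth: "norm (b t x) \<le> B + L * norm (x - x0)"
      and growth': "norm (b' t x) \<le> B + L * norm (x - x0)" if t: "t \<in> {0..S}" for t x
      using norm_triangle_sub[of "b t x" "b t x0"] norm_triangle_sub[of "b' t x" "b' t x0"]
        lip[of t x x0] lip'[of t x x0] B1(2)[OF t] B2(2)[OF t] t
      by (auto simp: B_def)
    \<comment> \<open>Points of the smaller ball can be moved by \<open>2 * \<delta>'\<close> inside
      the ball of radius \<open>\<delta>\<close>, and the Lipschitz loss of such a move is at most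
      \<open>c / 2\<close>.\<close>
    define \<delta>' where "\<delta>' = min (\<delta> / 3) (c / (4 * (L + 1)))"
    have \<delta>': "0 < \<delta>'" "3 * \<delta>' \<le> \<delta>" using pos L by (auto simp: \<delta>'_def)
    have "\<delta>' * (4 * (L + 1)) \<le> c"
      using L by (simp add: \<delta>'_def flip: pos_le_divide_eq)
    then have L\<delta>': "L * (2 * \<delta>') \<le> c / 2" using \<delta>' by (simp add: algebra_simps)
    have height: "\<bar>x \<bullet> e\<bar> \<le> norm (x - x0)" for x
      using Cauchy_Schwarz_ineq2[of "x - x0" e] e(1) x0_e by (simp add: inner_diff_left)
    have ee: "e \<bullet> e = 1" using e(1) by (simp add: dot_square_norm)
    have transversal': "c / 2 \<le> b t x \<bullet> e" if t: "t \<in> {0..T}" and x: "norm (x - x0) \<le> \<delta>'" for t x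
    proof (cases "0 < x \<bullet> e")
      case True
      have "c \<le> b t x \<bullet> e" using t x True \<delta>' by (intro transversal) auto
      then show ?thesis using pos by simp
    next
      case False
      \<comment> \<open>Raise \<open>x\<close> along the normal to height \<open>\<delta>'\<close>,
        strictly inside the half-space to which \<open>transversal\<close> applies.\<close>
      define y where "y = x + (\<delta>' - x \<bullet> e) *\<^sub>R e"
      have xy: "norm (y - x) \<le> 2 * \<delta>'"
        using height[of x] x False e(1) by (simp add: y_def)
      have "y \<bullet> e = \<delta>'" by (simp add: y_def inner_add_left ee)
      moreover have "norm (y - x0) \<le> \<delta>"
        using norm_triangle_ineq[of "y - x" "x - x0"] xy x \<delta>' by simp
      ultimately have "c \<le> b t y \<bullet> e" using t \<delta>' by (intro transversal) auto
      moreover have "(b t y - b t x) \<bullet> e \<le> norm (b t y - b t x)"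
        using norm_cauchy_schwarz[of "b t y - b t x" e] e(1) by simp
      moreover have "norm (b t y - b t x) \<le> L * norm (y - x)" using lip t by simp
      moreover have "L * norm (y - x) \<le> L * (2 * \<delta>')" using xy L by (intro mult_left_mono) auto
      ultimately show ?thesis using L\<delta>' by (simp add: inner_diff_left)
    qed
    have not_repelled': "L * (x \<bullet> e) \<le> f t x \<bullet> e"
      if t: "t \<in> {0..T}" and x: "norm (x - x0) \<le> \<delta>'" and below: "x \<bullet> e \<le> 0" for t x
    proof (cases "f t x = b t x")
      \<comment> \<open>This case can occur on the hyperplane itself, whose points follow
        \<open>b\<close> or \<open>b'\<close> according to how \<open>f\<close> is glued.\<close>
      case True
      moreover have "L * (x \<bullet> e) \<le> 0" using L below by (rule mult_nonneg_nonpos)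
      ultimately show ?thesis using transversal'[OF t x] pos by simp
    next
      case False
      then have f_b': "f t x = b' t x" using f(2) by blast
      \<comment> \<open>The orthogonal projection onto the hyperplane, where the sign of
        \<open>b'\<close> is known.\<close>
      define y where "y = x - (x \<bullet> e) *\<^sub>R e"
      have xy: "norm (y - x) = - (x \<bullet> e)" using below e(1) by (simp add: y_def)
      have "y \<bullet> e = 0" by (simp add: y_def inner_diff_left ee)
      moreover have "norm (y - x0) \<le> \<delta>"
        using norm_triangle_ineq[of "y - x" "x - x0"] xy x height[of x] \<delta>' by simp
      ultimately have "0 \<le> b' t y \<bullet> e" using t by (intro not_repelled) auto
      moreover have "(b' t y - b' t x) \<bullet> e \<le> norm (b' t y - b' t x)"
        using norm_cauchy_schwarz[of "b' t y - b' t x" e] e(1) by simp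
      moreover have "norm (b' t y - b' t x) \<le> L * - (x \<bullet> e)" using lip'[of t y x] t xy by simp
      ultimately show ?thesis using f_b' by (simp add: inner_diff_left)
    qed
    have "((\<lambda>t. B * t * exp (L * t)) \<longlongrightarrow> B * 0 * exp (L * 0)) (at_right 0)"
      by (intro tendsto_intros)
    then have "eventually (\<lambda>t. B * t * exp (L * t) < \<delta>') (at_right 0)"
      using \<delta>' by (auto dest: order_tendstoD(2))
    moreover have "eventually (\<lambda>t. t \<in> {0<..<min T S}) (at_right 0)"
      using pos S by (intro eventually_at_right_real) auto
    ultimately have "eventually (\<lambda>t. B * t * exp (L * t) < \<delta>' \<and> t \<in> {0<..<min T S}) (at_right 0)"
      by (rule eventually_conj)
    then obtain T' where T': "B * T' * exp (L * T') < \<delta>'" "0 < T'" "T' < T" "T' < S"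
      using eventually_happens'[OF trivial_limit_at_right_real] by fastforce
    have w_S: "continuous_on {0..S} w" using w(1) by (auto elim: continuous_on_subset)
    from compact_imp_bounded[OF compact_continuous_image[OF this compact_Icc]]
    obtain W where W: "\<And>t. t \<in> {0..S} \<Longrightarrow> norm (w t) \<le> W"
      unfolding bounded_iff by blast
    interpret transversal_limit e x0 f b L B "c / 2" \<delta>' T' S w W E Y Z
    proof
      show "norm (f t x) \<le> B + L * norm (x - x0)" if "t \<in> {0..S}" for t x
        using f(2)[of t x] growth[OF that] growth'[OF that] by metis
      show "driven_path f x0 (\<lambda>t. \<epsilon> *\<^sub>R w t) S (Y \<epsilon>)" if "\<epsilon> \<in> E" for \<epsilon>
        using S by (intro driven_path_solves_integral_eq[OF Y[OF that]]) auto
      show "driven_path b x0 (\<lambda>_. 0) S Z"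
        using S by (intro driven_path_solves_integral_eq[OF Z_sol])
          (auto intro: order_trans[OF _ S(2)])
      show "Z t \<bullet> e \<noteq> 0" if t: "t \<in> {0<..<S}" for t
      proof
        assume "Z t \<bullet> e = 0"
        then have "\<tau> \<le> ereal t"
          using t e unfolding \<tau>_def hitting_time_def by (intro Inf_lower) auto
        with S(2) t show False by (meson ereal_less_eq(3) greaterThanLessThan_iff not_le order_trans)
      qed
    qed (use e x0_e L B pos \<delta>' T' S growth lip f transversal' not_repelled' w w_S W osc E in auto)
    show ?thesis
    proof (rule uniform_limitI)
      fix \<kappa> :: real assume "0 < \<kappa>"
      from uniform_limitD[OF uniform_limit_paths this]
      show "eventually (\<lambda>\<epsilon>. \<forall>t\<in>K. dist (stopped \<tau> (Y \<epsilon>) t) (stopped \<tau> Z t) < \<kappa>) (at 0 within E)"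
        by eventually_elim (use stopped_eq in metis)
    qed
  qed
  then show "uniform_limit K (\<lambda>\<epsilon>. stopped (hitting_time d Z) (Y \<epsilon>))
      (stopped (hitting_time d Z) Z) (at 0 within E)"
    by (simp add: \<tau>_def)
qed

text \<open>The sign \<open>s\<close> selects the half-space that is entered. The noise properties
  and, by \<open>common_null_set\<close>, the equations for all \<open>\<epsilon> \<in> E\<close>
  hold off a single null set, on whose complement \<open>stopped_path_limit\<close> applies.\<close>

lemma AE_stopped_limit:
  fixes b b' f :: "real \<Rightarrow> real ^ 'n \<Rightarrow> real ^ 'n" and d :: "'n::finite"
  assumes b: "admissible_drift b" and b': "admissible_drift b'"
    and w: "wiener_process M w" and x0: "x0 \<in> hyperplane d"
    and s: "s = 1 \<or> s = - 1"
    and f: "\<And>t x. 0 < s * x $ d \<Longrightarrow> f t x = b t x" "\<And>t x. f t x = b t x \<or> f t x = b' t x"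
    and Z: "solves_until_hitting d b x0 Z"
    and E: "E \<subseteq> {0<..}" "common_null_set M w f x0 E X"
    and pos: "0 < T" "0 < \<delta>" "0 < c"
    and transversal: "\<And>t x. t \<in> {0..T} \<Longrightarrow> 0 < s * x $ d \<Longrightarrow> norm (x - x0) \<le> \<delta> \<Longrightarrow> c \<le> s * b t x $ d"
    and not_repelled: "\<And>t x. t \<in> {0..T} \<Longrightarrow> x \<in> hyperplane d \<Longrightarrow> norm (x - x0) \<le> \<delta> \<Longrightarrow> 0 \<le> s * b' t x $ d"
  shows "AE \<omega> in M. locally_uniform_limit
           (\<lambda>\<epsilon>. stopped (hitting_time d Z) (\<lambda>t. X \<epsilon> t \<omega>))
           (stopped (hitting_time d Z) Z) (at 0 within E)"
proof -
  define e :: "real ^ 'n" where "e = s *\<^sub>R axis d 1"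
  have dot: "x \<bullet> e = s * x $ d" for x by (simp add: e_def inner_axis)
  have e: "norm e = 1" "hyperplane d = {x. x \<bullet> e = 0}"
    using s by (auto simp: e_def hyperplane_def inner_axis)
  have "AE \<omega> in M. continuous_on {0..} (\<lambda>t. w t \<omega>)" "AE \<omega> in M. w 0 \<omega> = 0"
    using w by (auto simp: wiener_process_def)
  moreover have "AE \<omega> in M. \<forall>C. \<forall>\<eta>>0. \<exists>t\<in>{0<..<\<eta>}. C * t < w t \<omega> \<bullet> e"
    unfolding e_def by (rule wiener_process_AE_oscillation[OF w s])
  moreover have "AE \<omega> in M. \<forall>\<epsilon>\<in>E. solves_integral_eq f x0 (\<lambda>t. \<epsilon> *\<^sub>R w t \<omega>) {0..} (\<lambda>t. X \<epsilon> t \<omega>)"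
    using E(2) by (simp add: common_null_set_def)
  ultimately show ?thesis
  proof eventually_elim
    case (elim \<omega>)
    show ?case
      by (rule stopped_path_limit[OF b b' e x0 _ f(2) elim(1,2) _ E(1) _ Z pos])
        (use elim f(1) transversal not_repelled e(2) in \<open>auto simp: dot\<close>)
  qed
qed

theorem theorem3:
  fixes d :: "'n::finite"
    and bp bm :: "real \<Rightarrow> real ^ 'n \<Rightarrow> real ^ 'n"
    and M :: "'a measure"
    and w :: "real \<Rightarrow> 'a \<Rightarrow> real ^ 'n"
    and X :: "real \<Rightarrow> real \<Rightarrow> 'a \<Rightarrow> real ^ 'n"
    and Xp Xm :: "real \<Rightarrow> real ^ 'n"
    and x0 :: "real ^ 'n"
    and E :: "real set"
  assumes "admissible_drift bp" and "admissible_drift bm"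
    and "wiener_process M w"
    and "x0 \<in> hyperplane d"
    and "\<And>\<epsilon>. \<epsilon> > 0 \<Longrightarrow> strong_solution M w (glued_drift d bp bm) x0 \<epsilon> (X \<epsilon>)"
    and "solves_until_hitting d bp x0 Xp"
    and "solves_until_hitting d bm x0 Xm"
    and "E \<subseteq> {0<..}" and "common_null_set M w (glued_drift d bp bm) x0 E X"
  shows
    "((\<exists>T>0. \<exists>\<delta>>0. \<exists>c>0. \<forall>t\<in>{0..T}.
         (\<forall>x. x $ d > 0 \<longrightarrow> norm (x - x0) \<le> \<delta> \<longrightarrow> bp t x $ d \<ge> c) \<and>
         (\<forall>x\<in>hyperplane d. norm (x - x0) \<le> \<delta> \<longrightarrow> bm t x $ d \<ge> 0)) \<longrightarrow>
      (AE \<omega> in M. locally_uniform_limit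
         (\<lambda>\<epsilon>. stopped (hitting_time d Xp) (\<lambda>t. X \<epsilon> t \<omega>))
         (stopped (hitting_time d Xp) Xp) (at 0 within E))) \<and>
     ((\<exists>T>0. \<exists>\<delta>>0. \<exists>c>0. \<forall>t\<in>{0..T}.
         (\<forall>x. x $ d < 0 \<longrightarrow> norm (x - x0) \<le> \<delta> \<longrightarrow> bm t x $ d \<le> - c) \<and>
         (\<forall>x\<in>hyperplane d. norm (x - x0) \<le> \<delta> \<longrightarrow> bp t x $ d \<le> 0)) \<longrightarrow>
      (AE \<omega> in M. locally_uniform_limit
         (\<lambda>\<epsilon>. stopped (hitting_time d Xm) (\<lambda>t. X \<epsilon> t \<omega>))
         (stopped (hitting_time d Xm) Xm) (at 0 within E)))"
proof (intro conjI impI; elim exE conjE)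
  fix T \<delta> c :: real
  assume pos: "0 < T" "0 < \<delta>" "0 < c" and *: "\<forall>t\<in>{0..T}.
         (\<forall>x. x $ d > 0 \<longrightarrow> norm (x - x0) \<le> \<delta> \<longrightarrow> bp t x $ d \<ge> c) \<and>
         (\<forall>x\<in>hyperplane d. norm (x - x0) \<le> \<delta> \<longrightarrow> bm t x $ d \<ge> 0)"
  show "AE \<omega> in M. locally_uniform_limit
         (\<lambda>\<epsilon>. stopped (hitting_time d Xp) (\<lambda>t. X \<epsilon> t \<omega>))
         (stopped (hitting_time d Xp) Xp) (at 0 within E)"
    by (rule AE_stopped_limit[where s = 1, OF assms(1,2,3,4) _ _ _ assms(6,8,9) pos])
      (use * in \<open>auto simp: glued_drift_def\<close>)
next
  fix T \<delta> c :: real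
  assume pos: "0 < T" "0 < \<delta>" "0 < c" and *: "\<forall>t\<in>{0..T}.
         (\<forall>x. x $ d < 0 \<longrightarrow> norm (x - x0) \<le> \<delta> \<longrightarrow> bm t x $ d \<le> - c) \<and>
         (\<forall>x\<in>hyperplane d. norm (x - x0) \<le> \<delta> \<longrightarrow> bp t x $ d \<le> 0)"
  show "AE \<omega> in M. locally_uniform_limit
         (\<lambda>\<epsilon>. stopped (hitting_time d Xm) (\<lambda>t. X \<epsilon> t \<omega>))
         (stopped (hitting_time d Xm) Xm) (at 0 within E)"
    \<comment> \<open>The two drifts exchange roles. Points of the hyperplane still follow
      \<open>bp\<close>, which is compatible because \<open>f\<close> must agree with
      \<open>bm\<close> strictly below it only.\<close>
    by (rule AE_stopped_limit[where s = "- 1", OF assms(2,1,3,4) _ _ _ assms(7,8,9) pos])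
      (use * in \<open>auto simp: glued_drift_def le_minus_iff\<close>)
qed

end
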